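(* Consider the problem $\min_{x\in\mathcal X} f(x)$, $f=\frac1n\sum_{i=1}^n f_i$, where $\mathcal X\subset\mathbb R^d$ is nonempty, convex and compact with $\|x-y\|\le D$ for all $x,y\in\mathcal X$; $f$ is $L$-smooth on $\mathcal X$; each $f_i$ is $L_i$-smooth on $\mathcal X$; and $f$ is convex on $\mathcal X$ (the individual $f_i$ need not be convex). Let $\tilde L^2=\frac1n\sum_{i=1}^n L_i^2$ and let $x^*$ be a minimizer of $f$ on $\mathcal X$. Let $\{x^k\}$ be the iterates of the Saga Sarah Frank-Wolfe algorithm (described in the context) with batch size $b$ and momentum $\lambda=\frac b{2n}$. For any integer $K\ge1$, choose the step sizes, for $0\le k\le K-1$, as $$\eta_k=\begin{cases}\dfrac b{4n}, & \text{if } K\le \dfrac{4n}b,\\[2mm] \dfrac b{4n}, & \text{if } K>\dfrac{4n}b \text{ and } k<\lceil K/2\rceil,\\[2mm] \dfrac{2}{8n/b+k-\lceil K/2\rceil}, & \text{if } K>\dfrac{4n}b\text{ and } k\ge\lceil K/2\rceil.\end{cases}$$ Then $$\mathbb E\left[f(x^K)-f(x^* )\right]=\mathcal O\left(\frac{n\left[f(x^0)-f(x^* )\right]}{b}\exp\left(-\frac{bK}{8n}\right)+\left[1+\frac{\tilde L\sqrt n}{Lb}\right]\frac{LD^2}{K}\right),$$ where $\mathcal O(\cdot)$ hides an absolute numerical constant.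
   Context: Norms and inner products are Euclidean and $[n]=\{1,\dots,n\}$. The $f_i$ are real-valued and differentiable on $\mathcal X$ (say, on an open neighbourhood of $\mathcal X$). A function $h$ is $M$-smooth on $\mathcal X$ ($M>0$) if $\|\nabla h(x)-\nabla h(y)\|\le M\|x-y\|$ for all $x,y\in\mathcal X$. Convexity of $f$ on $\mathcal X$ means $f(x)\ge f(y)+\langle\nabla f(y),x-y\rangle$ for all $x,y\in\mathcal X$. The constants satisfy $L,L_i,D>0$. Saga Sarah Frank-Wolfe algorithm. Parameters: step sizes $\{\eta_k\}$, momentum $\lambda$, integer batch size $b$ with $1\le b\le n$. Initialization: $x^0\in\mathcal X$ (deterministic), $g^0=\nabla f(x^0)$, $y_i^0=\nabla f_i(x^0)$ for $i\in[n]$. For $k=0,1,\dots,K-1$: (1) $s^k\in\arg\min_{s\in\mathcal X}\langle g^k,s\rangle$ (any minimizer, chosen as a measurable function of the past); (2) $x^{k+1}=x^k+\eta_k(s^k-x^k)$; (3) draw a batch $S_k$ of $b$ indices uniformly at random from $[n]$ (i.i.d., with repetitions counted in sums over $S_k$), independent of the past; (4) $g^{k+1}=\frac1b\sum_{i\in S_k}[\nabla f_i(x^{k+1})-\nabla f_i(x^k)]+(1-\lambda)g^k+\lambda\left(\frac1b\sum_{i\in S_k}[\nabla f_i(x^k)-y_i^k]+\frac1n\sum_{j=1}^n y_j^k\right)$; (5) $y_i^{k+1}=\nabla f_i(x^{k+1})$ if $i\in S_k$, and $y_i^{k+1}=y_i^k$ if $i\notin S_k$. The statement "$A=\mathcal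 O(B)$" means $A\le C\,B$ for an absolute constant $C$ independent of the problem instance, $n,d,b,K$ and $x^0$. *)

theory Defs
  imports "HOL-Probability.Probability" "HOL-Library.Poly_Mapping"
begin

(* The constant hidden in O(.) must not depend on the dimension d, so d has to be bound inside
   the statement and cannot be a type. R^d is therefore taken to be the coordinate subspace
   {x. x_i = 0 for all i >= d} of the space of finitely supported real sequences, with the
   Euclidean inner product; coordinates are numbered 0, ..., d - 1. *)

instantiation poly_mapping :: (type, real_vector) real_vector
begin

lift_definition scaleR_poly_mapping :: "real \<Rightarrow> ('a \<Rightarrow>\<^sub>0 'b) \<Rightarrow> ('a \<Rightarrow>\<^sub>0 'b)"
  is "\<lambda>r x i. r *\<^sub>R x i"
  by (rule finite_subset) auto

instance
  by standard (transfer, simp add: fun_eq_iff scaleR_add_right scaleR_add_left)+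

end

instantiation poly_mapping :: (type, real_inner) real_inner
begin

definition inner_poly_mapping :: "('a \<Rightarrow>\<^sub>0 'b) \<Rightarrow> ('a \<Rightarrow>\<^sub>0 'b) \<Rightarrow> real"
  where "inner_poly_mapping x y = (\<Sum>i\<in>Poly_Mapping.keys x. Poly_Mapping.lookup x i \<bullet> Poly_Mapping.lookup y i)"

definition norm_poly_mapping :: "('a \<Rightarrow>\<^sub>0 'b) \<Rightarrow> real"
  where "norm_poly_mapping x = sqrt (x \<bullet> x)"

definition dist_poly_mapping :: "('a \<Rightarrow>\<^sub>0 'b) \<Rightarrow> ('a \<Rightarrow>\<^sub>0 'b) \<Rightarrow> real"
  where "dist_poly_mapping x y = norm (x - y)"

definition sgn_poly_mapping :: "('a \<Rightarrow>\<^sub>0 'b) \<Rightarrow> ('a \<Rightarrow>\<^sub>0 'b)"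
  where "sgn_poly_mapping x = x /\<^sub>R norm x"

definition uniformity_poly_mapping :: "(('a \<Rightarrow>\<^sub>0 'b) \<times> ('a \<Rightarrow>\<^sub>0 'b)) filter"
  where "uniformity_poly_mapping = (INF e\<in>{0<..}. principal {(x, y). dist x y < e})"

definition open_poly_mapping :: "('a \<Rightarrow>\<^sub>0 'b) set \<Rightarrow> bool"
  where "open_poly_mapping U \<longleftrightarrow> (\<forall>x\<in>U. eventually (\<lambda>(x', y). x' = x \<longrightarrow> y \<in> U) uniformity)"

lemma inner_poly_mapping_superset:
  assumes "finite A" "Poly_Mapping.keys x \<subseteq> A"
  shows "x \<bullet> y = (\<Sum>i\<in>A. Poly_Mapping.lookup x i \<bullet> Poly_Mapping.lookup y i)"
  unfolding inner_poly_mapping_def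
  by (rule sum.mono_neutral_left) (use assms in \<open>auto simp: in_keys_iff\<close>)

instance
proof
  fix x y z :: "'a \<Rightarrow>\<^sub>0 'b" and r :: real
  let ?A = "Poly_Mapping.keys x \<union> Poly_Mapping.keys y \<union> Poly_Mapping.keys z"
  have A: "finite ?A" "Poly_Mapping.keys x \<subseteq> ?A" "Poly_Mapping.keys y \<subseteq> ?A" "Poly_Mapping.keys (x + y) \<subseteq> ?A" "Poly_Mapping.keys (r *\<^sub>R x) \<subseteq> ?A"
    using keys_add[of x y] by (auto simp: in_keys_iff scaleR_poly_mapping.rep_eq)
  note S = inner_poly_mapping_superset[of ?A, OF A(1)]
  show "x \<bullet> y = y \<bullet> x"
    by (simp add: S[OF A(2)] S[OF A(3)] inner_commute)
  show "(x + y) \<bullet> z = x \<bullet> z + y \<bullet> z"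
    by (simp add: S[OF A(2)] S[OF A(3)] S[OF A(4)] Poly_Mapping.lookup_add inner_add_left sum.distrib)
  show "r *\<^sub>R x \<bullet> y = r * (x \<bullet> y)"
    by (simp add: S[OF A(2)] S[OF A(5)] scaleR_poly_mapping.rep_eq sum_distrib_left)
  show "0 \<le> x \<bullet> x"
    by (simp add: inner_poly_mapping_def sum_nonneg)
  show "x \<bullet> x = 0 \<longleftrightarrow> x = 0"
    by (auto simp: inner_poly_mapping_def sum_nonneg_eq_0_iff in_keys_iff intro: poly_mapping_eqI)
qed (simp_all add: norm_poly_mapping_def dist_poly_mapping_def sgn_poly_mapping_def
      uniformity_poly_mapping_def open_poly_mapping_def)

end

type_synonym vec = "nat \<Rightarrow>\<^sub>0 real"

definition Rd :: "nat \<Rightarrow> vec set"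
  where "Rd d = {x. \<forall>i\<ge>d. Poly_Mapping.lookup x i = 0}"

lemma inner_Rd:
  assumes "x \<in> Rd d"
  shows "x \<bullet> y = (\<Sum>i<d. Poly_Mapping.lookup x i * Poly_Mapping.lookup y i)"
proof -
  have "Poly_Mapping.keys x \<subseteq> {..<d}"
    using assms by (force simp: Rd_def in_keys_iff not_less[symmetric])
  then show ?thesis
    using inner_poly_mapping_superset[of "{..<d}" x y] by simp
qed

lemma norm_Rd:
  assumes "x \<in> Rd d"
  shows "norm x = sqrt (\<Sum>i<d. (Poly_Mapping.lookup x i)\<^sup>2)"
  by (simp add: norm_poly_mapping_def inner_Rd[OF assms] power2_eq_square)

(* The derivative is taken relative to R^d, i.e. h is only looked at on R^d. *)
definition grad :: "nat \<Rightarrow> (vec \<Rightarrow> real) \<Rightarrow> vec \<Rightarrow> vec"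
  where "grad d h x = (THE v. v \<in> Rd d \<and> (h has_derivative (\<lambda>u. v \<bullet> u)) (at x within Rd d))"

definition differentiable_near :: "nat \<Rightarrow> vec set \<Rightarrow> (vec \<Rightarrow> real) \<Rightarrow> bool"
  where "differentiable_near d X h \<longleftrightarrow>
    (\<exists>U. openin (top_of_set (Rd d)) U \<and> X \<subseteq> U \<and> (\<forall>x\<in>U. h differentiable (at x within Rd d)))"

definition smooth_on :: "nat \<Rightarrow> vec set \<Rightarrow> real \<Rightarrow> (vec \<Rightarrow> real) \<Rightarrow> bool"
  where "smooth_on d X M h \<longleftrightarrow> (\<forall>x\<in>X. \<forall>y\<in>X. norm (grad d h x - grad d h y) \<le> M * norm (x - y))"

definition grad_convex_on :: "nat \<Rightarrow> vec set \<Rightarrow> (vec \<Rightarrow> real) \<Rightarrow> bool"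
  where "grad_convex_on d X h \<longleftrightarrow> (\<forall>x\<in>X. \<forall>y\<in>X. h x \<ge> h y + grad d h y \<bullet> (x - y))"

definition avg :: "nat \<Rightarrow> (nat \<Rightarrow> vec \<Rightarrow> real) \<Rightarrow> vec \<Rightarrow> real"
  where "avg n f x = (\<Sum>i\<in>{1..n}. f i x) / real n"

(* A batch is the list of its b independent uniform draws; a sample point S is the list
   [S_0, ..., S_{K-1}] of the K independent batches. *)
definition batches_pmf :: "nat \<Rightarrow> nat \<Rightarrow> nat \<Rightarrow> nat list list pmf"
  where "batches_pmf n b K = replicate_pmf K (replicate_pmf b (pmf_of_set {1..n}))"

(* x k S, g k S, y k S i are the values of x^k, g^k, y_i^k at the sample point S. Only the batches
   are random, so the past at step k is take k S = [S_0, ..., S_{k-1}] and the linear minimizer s^k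
   is s (take k S) for a selection rule s; measurability is automatic, as the past takes only
   finitely many values. *)
definition saga_sarah_fw ::
  "nat \<Rightarrow> vec set \<Rightarrow> nat \<Rightarrow> (nat \<Rightarrow> vec \<Rightarrow> real) \<Rightarrow> nat \<Rightarrow> real \<Rightarrow> (nat \<Rightarrow> real) \<Rightarrow> nat \<Rightarrow> vec \<Rightarrow>
   (nat list list \<Rightarrow> vec) \<Rightarrow> (nat \<Rightarrow> nat list list \<Rightarrow> vec) \<Rightarrow> (nat \<Rightarrow> nat list list \<Rightarrow> vec) \<Rightarrow>
   (nat \<Rightarrow> nat list list \<Rightarrow> nat \<Rightarrow> vec) \<Rightarrow> bool"
  where "saga_sarah_fw d X n f b lam \<eta> K x0 s x g y \<longleftrightarrow>
    (\<forall>S \<in> set_pmf (batches_pmf n b K).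
      x 0 S = x0 \<and>
      g 0 S = grad d (avg n f) x0 \<and>
      (\<forall>i\<in>{1..n}. y 0 S i = grad d (f i) x0) \<and>
      (\<forall>k<K.
        is_arg_min (\<lambda>u. g k S \<bullet> u) (\<lambda>u. u \<in> X) (s (take k S)) \<and>
        x (Suc k) S = x k S + \<eta> k *\<^sub>R (s (take k S) - x k S) \<and>
        g (Suc k) S =
          (1 / real b) *\<^sub>R (\<Sum>i\<leftarrow>S ! k. grad d (f i) (x (Suc k) S) - grad d (f i) (x k S))
          + (1 - lam) *\<^sub>R g k S
          + lam *\<^sub>R ((1 / real b) *\<^sub>R (\<Sum>i\<leftarrow>S ! k. grad d (f i) (x k S) - y k S i)
                     + (1 / real n) *\<^sub>R (\<Sum>j\<in>{1..n}. y k S j)) \<and>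
        (\<forall>i\<in>{1..n}. y (Suc k) S i =
          (if i \<in> set (S ! k) then grad d (f i) (x (Suc k) S) else y k S i))))"

definition step_size :: "nat \<Rightarrow> nat \<Rightarrow> nat \<Rightarrow> nat \<Rightarrow> real"
  where "step_size n b K k =
    (if real K \<le> 4 * real n / real b then real b / (4 * real n)
     else if int k < \<lceil>real K / 2\<rceil> then real b / (4 * real n)
     else 2 / (8 * real n / real b + real k - of_int \<lceil>real K / 2\<rceil>))"

end

theory Submission
  imports Defs
begin

text \<open>
  Let \<open>p = b / n\<close>, let \<open>e\<^sub>k\<close> be the difference between the gradient estimator and the true gradient
  at the \<open>k\<close>-th iterate, let \<open>\<sigma>\<^sub>k\<close> be the mean square distance of the stored gradients from the
  current ones, and let \<open>F\<^sub>k\<close> be the suboptimality of the \<open>k\<close>-th iterate.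

  Smoothness, convexity and optimality of the linear minimizer give
  \<open>F\<^sub>k\<^sub>+\<^sub>1 \<le> (1 - \<eta>\<^sub>k) F\<^sub>k + \<eta>\<^sub>k D \<parallel>e\<^sub>k\<parallel> + L D\<^sup>2 \<eta>\<^sub>k\<^sup>2 / 2\<close> (lemma \<open>suboptimality_step\<close>), so the estimator
  has to be accurate up to the order of \<open>\<eta>\<^sub>k\<close>.  Write \<open>N\<^sub>k\<close> for \<open>D\<^sup>2 \<eta>\<^sub>k\<^sup>2\<close> times the mean of the
  \<open>L\<^sub>i\<^sup>2\<close>; it bounds the mean square change of the component gradients in one step.  In conditional
  expectation given the past,
  \<open>\<parallel>e\<^sub>k\<^sub>+\<^sub>1\<parallel>\<^sup>2 \<le> (1 - 3 p / 4) \<parallel>e\<^sub>k\<parallel>\<^sup>2 + (2 / b) N\<^sub>k + (p\<^sup>2 / (2 b)) \<sigma>\<^sub>k\<close> (lemma \<open>err_step\<close>) and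
  \<open>\<sigma>\<^sub>k\<^sub>+\<^sub>1 \<le> (1 - 3 p / 8) \<sigma>\<^sub>k + (5 / p) N\<^sub>k\<close> (lemma \<open>staleness_step\<close>).
  Both \<open>e\<^sub>0\<close> and \<open>\<sigma>\<^sub>0\<close> vanish, and the combination \<open>\<parallel>e\<^sub>k\<parallel>\<^sup>2 + (8 p / b) \<sigma>\<^sub>k\<close> contracts faster than
  \<open>\<eta>\<^sub>k\<^sup>2\<close> shrinks.  It is therefore of order \<open>N\<^sub>k / (b p)\<close> throughout, in both phases of the step
  sizes (lemmas \<open>lyapunov_tracks_step_size\<close> and \<open>second_moment_err\<close>).

  What remains is the scalar recursion \<open>F\<^sub>k\<^sub>+\<^sub>1 \<le> (1 - \<eta>\<^sub>k) F\<^sub>k + M \<eta>\<^sub>k\<^sup>2\<close> for the expected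
  suboptimality, whose solution is bounded in lemma \<open>step_size_rate\<close>.

  All expectations are over finitely many outcomes.  Conditioning on the past is expressed by
  redrawing a single batch of the sample (lemma \<open>expectation_replicate_pmf_resample\<close>).
\<close>

section \<open>Gradients relative to a coordinate subspace\<close>

lemma subspace_Rd: "subspace (Rd d)"
  by (auto simp: subspace_def Rd_def Poly_Mapping.lookup_add scaleR_poly_mapping.rep_eq)

lemma single_in_Rd: "i < d \<Longrightarrow> Poly_Mapping.single i r \<in> Rd d"
  by (auto simp: Rd_def lookup_single when_def)

lemma Rd_expansion:
  assumes "u \<in> Rd d"
  shows "u = (\<Sum>i<d. Poly_Mapping.lookup u i *\<^sub>R Poly_Mapping.single i 1)"
proof (rule poly_mapping_eqI)
  fix k
  have "Poly_Mapping.lookup (\<Sum>i<d. Poly_Mapping.lookup u i *\<^sub>R Poly_Mapping.single i (1::real)) k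
      = (\<Sum>i<d. if i = k then Poly_Mapping.lookup u i else 0)"
    unfolding lookup_sum
    by (rule sum.cong) (auto simp: scaleR_poly_mapping.rep_eq lookup_single when_def)
  also have "\<dots> = Poly_Mapping.lookup u k"
    using assms by (auto simp: Rd_def not_less)
  finally show "Poly_Mapping.lookup u k =
      Poly_Mapping.lookup (\<Sum>i<d. Poly_Mapping.lookup u i *\<^sub>R Poly_Mapping.single i 1) k" ..
qed

lemma has_derivative_along_line:
  assumes "(h has_derivative (\<lambda>u. v \<bullet> u)) (at (a + t *\<^sub>R u) within Rd d)"
    and "a \<in> Rd d" "u \<in> Rd d"
  shows "((\<lambda>t. h (a + t *\<^sub>R u)) has_real_derivative v \<bullet> u) (at t)"
proof -
  have line: "((\<lambda>t. a + t *\<^sub>R u) has_derivative (\<lambda>t. t *\<^sub>R u)) (at t)"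
    by (auto intro!: derivative_eq_intros)
  have "range (\<lambda>t. a + t *\<^sub>R u) \<subseteq> Rd d"
    using assms(2,3) subspace_Rd by (auto intro!: subspace_add subspace_scale)
  with assms(1) have "(h has_derivative (\<lambda>u. v \<bullet> u))
      (at (a + t *\<^sub>R u) within range (\<lambda>t. a + t *\<^sub>R u))"
    by (rule has_derivative_subset)
  from has_derivative_in_compose[OF line this] show ?thesis
    by (simp add: has_field_derivative_def mult.commute[of "_ \<bullet> _"] mult_commute_abs)
qed

text \<open>
  Testing both candidates along the direction \<open>v - w\<close>, which stays inside \<open>Rd d\<close>, is enough.
\<close>
lemma gradient_unique:
  assumes "(h has_derivative (\<lambda>u. v \<bullet> u)) (at a within Rd d)"
    and "(h has_derivative (\<lambda>u. w \<bullet> u)) (at a within Rd d)"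
    and "a \<in> Rd d" "v \<in> Rd d" "w \<in> Rd d"
  shows "v = w"
proof -
  let ?u = "v - w"
  have u: "?u \<in> Rd d"
    using assms subspace_Rd by (intro subspace_diff)
  have "v \<bullet> ?u = w \<bullet> ?u"
    using has_derivative_along_line[of h v a 0 ?u d] has_derivative_along_line[of h w a 0 ?u d]
      assms u DERIV_unique by simp blast
  then have "?u \<bullet> ?u = 0"
    by (simp add: inner_diff_left)
  then show ?thesis by simp
qed

lemma grad_eqI:
  assumes "(h has_derivative (\<lambda>u. v \<bullet> u)) (at a within Rd d)" "a \<in> Rd d" "v \<in> Rd d"
  shows "grad d h a = v"
  unfolding grad_def using assms gradient_unique by (intro the_equality) blast+

text \<open>
  The description defining \<^const>\<open>grad\<close> denotes the gradient at every point of differentiability: the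
  Riesz representative of the derivative in the coordinate subspace has the partial derivatives as
  its coordinates.
\<close>
lemma grad_differentiable:
  assumes "h differentiable (at a within Rd d)" "a \<in> Rd d"
  shows "grad d h a \<in> Rd d"
    and "(h has_derivative (\<lambda>u. grad d h a \<bullet> u)) (at a within Rd d)"
proof -
  obtain h' where h': "(h has_derivative h') (at a within Rd d)"
    using assms(1) by (auto simp: differentiable_def)
  then interpret h': bounded_linear h'
    by (rule has_derivative_bounded_linear)
  define v :: vec where "v = (\<Sum>i<d. h' (Poly_Mapping.single i 1) *\<^sub>R Poly_Mapping.single i 1)"
  have v: "v \<in> Rd d"
    unfolding v_def using subspace_Rd by (intro subspace_sum subspace_scale single_in_Rd) auto
  have lookup_v: "Poly_Mapping.lookup v k = h' (Poly_Mapping.single k 1)" if "k < d" for k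
  proof -
    have "Poly_Mapping.lookup v k = (\<Sum>i<d. if i = k then h' (Poly_Mapping.single i 1) else 0)"
      unfolding v_def lookup_sum
      by (rule sum.cong) (auto simp: scaleR_poly_mapping.rep_eq lookup_single when_def)
    with that show ?thesis by simp
  qed
  have repr: "h' u = v \<bullet> u" if "u \<in> Rd d" for u
  proof -
    have "h' u = (\<Sum>i<d. Poly_Mapping.lookup u i * h' (Poly_Mapping.single i 1))"
      by (subst Rd_expansion[OF that]) (simp add: h'.sum h'.scaleR)
    also have "\<dots> = v \<bullet> u"
      by (simp add: inner_Rd[OF v] lookup_v mult.commute)
    finally show ?thesis .
  qed
  have "(h has_derivative (\<lambda>u. v \<bullet> u)) (at a within Rd d)"
    unfolding has_derivative_within
  proof
    show "bounded_linear (\<lambda>u. v \<bullet> u)"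
      by (rule bounded_linear_inner_right)
    have "((\<lambda>y. (1 / norm (y - a)) *\<^sub>R (h y - (h a + h' (y - a)))) \<longlongrightarrow> 0) (at a within Rd d)"
      using h' by (simp add: has_derivative_within)
    then show "((\<lambda>y. (1 / norm (y - a)) *\<^sub>R (h y - (h a + v \<bullet> (y - a)))) \<longlongrightarrow> 0) (at a within Rd d)"
      by (rule Lim_transform_within[where d = 1])
        (use assms(2) subspace_Rd in \<open>auto simp: repr subspace_diff\<close>)
  qed
  then have D: "grad d h a = v" "(h has_derivative (\<lambda>u. v \<bullet> u)) (at a within Rd d)"
    using grad_eqI assms(2) v by auto
  show "grad d h a \<in> Rd d" and "(h has_derivative (\<lambda>u. grad d h a \<bullet> u)) (at a within Rd d)"
    using D v by simp_all
qed

lemma differentiable_nearD: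
  assumes "differentiable_near d X h" "a \<in> X"
  shows "h differentiable (at a within Rd d)"
  using assms by (auto simp: differentiable_near_def)

lemma grad_avg:
  assumes "\<And>i. i \<in> {1..n} \<Longrightarrow> f i differentiable (at a within Rd d)" "a \<in> Rd d"
  shows "grad d (avg n f) a = (1 / real n) *\<^sub>R (\<Sum>i\<in>{1..n}. grad d (f i) a)"
    and "avg n f differentiable (at a within Rd d)"
proof -
  let ?v = "(1 / real n) *\<^sub>R (\<Sum>i\<in>{1..n}. grad d (f i) a)"
  have "((\<lambda>u. (1 / real n) * (\<Sum>i\<in>{1..n}. f i u)) has_derivative
      (\<lambda>u. (1 / real n) * (\<Sum>i\<in>{1..n}. grad d (f i) a \<bullet> u))) (at a within Rd d)"
    by (intro has_derivative_mult_right has_derivative_sum grad_differentiable(2) assms)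
  then have D: "(avg n f has_derivative (\<lambda>u. ?v \<bullet> u)) (at a within Rd d)"
    by (simp add: avg_def[abs_def] inner_sum_left)
  moreover have "?v \<in> Rd d"
    using assms subspace_Rd by (intro subspace_scale subspace_sum grad_differentiable(1)) auto
  ultimately show "grad d (avg n f) a = ?v"
    using assms(2) by (intro grad_eqI)
  show "avg n f differentiable (at a within Rd d)"
    using D by (auto simp: differentiable_def)
qed

text \<open>
  The quadratic upper bound for a function with Lipschitz gradient.  The Lipschitz condition is
  needed only on the segment from \<open>u\<close> to \<open>v\<close>, and integration is avoided by checking that the defect
  \<open>\<psi>\<close> has a nonpositive derivative along it.
\<close>
lemma smooth_on_upper_bound:
  assumes "convex X" "X \<subseteq> Rd d" "u \<in> X" "v \<in> X" "smooth_on d X M h"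
    and diff: "\<And>a. a \<in> X \<Longrightarrow> h differentiable (at a within Rd d)"
  shows "h v \<le> h u + grad d h u \<bullet> (v - u) + M / 2 * (norm (v - u))\<^sup>2"
proof -
  let ?w = "v - u"
  define \<psi> where "\<psi> t = h (u + t *\<^sub>R ?w) - t * (grad d h u \<bullet> ?w) - M / 2 * t\<^sup>2 * (norm ?w)\<^sup>2" for t
  define \<psi>' where "\<psi>' t = grad d h (u + t *\<^sub>R ?w) \<bullet> ?w - grad d h u \<bullet> ?w - M * t * (norm ?w)\<^sup>2" for t
  have "\<psi> 1 \<le> \<psi> 0"
  proof (rule DERIV_nonpos_imp_nonincreasing[of 0 1 \<psi>])
    fix t :: real assume t: "0 \<le> t" "t \<le> 1"
    let ?a = "u + t *\<^sub>R ?w"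
    have "(1 - t) *\<^sub>R u + t *\<^sub>R v \<in> X"
      using assms t by (intro convexD) auto
    then have a: "?a \<in> X"
      by (simp add: algebra_simps)
    have "?w \<in> Rd d"
      using assms subspace_Rd by (intro subspace_diff) auto
    moreover have "(h has_derivative (\<lambda>z. grad d h ?a \<bullet> z)) (at ?a within Rd d)"
      using assms(2) a diff[OF a] by (blast intro: grad_differentiable(2))
    ultimately have "((\<lambda>t. h (u + t *\<^sub>R ?w)) has_real_derivative grad d h ?a \<bullet> ?w) (at t)"
      using assms(2,3) by (intro has_derivative_along_line) auto
    then have "(\<psi> has_real_derivative \<psi>' t) (at t)"
      unfolding \<psi>_def[abs_def] \<psi>'_def by (auto intro!: derivative_eq_intros)
    moreover have "\<psi>' t \<le> 0"
    proof -
      have "(grad d h ?a - grad d h u) \<bullet> ?w \<le> norm (grad d h ?a - grad d h u) * norm ?w"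
        by (rule norm_cauchy_schwarz)
      also have "\<dots> \<le> (M * norm (?a - u)) * norm ?w"
        using assms(3,5) a unfolding smooth_on_def by (intro mult_right_mono norm_ge_zero) blast
      also have "\<dots> = M * t * (norm ?w)\<^sup>2"
        using t by (simp add: power2_eq_square)
      finally show ?thesis
        by (simp add: \<psi>'_def inner_diff_left)
    qed
    ultimately show "\<exists>y. (\<psi> has_real_derivative y) (at t) \<and> y \<le> 0"
      by blast
  qed simp
  then show ?thesis
    by (simp add: \<psi>_def)
qed

section \<open>Expectations over finitely many outcomes\<close>

lemma expectation_bind_finite:
  fixes h :: "'b \<Rightarrow> real"
  assumes "finite (set_pmf p)" "\<And>x. x \<in> set_pmf p \<Longrightarrow> finite (set_pmf (q x))"
  shows "measure_pmf.expectation (p \<bind> q) h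
    = measure_pmf.expectation p (\<lambda>x. measure_pmf.expectation (q x) h)"
  using assms
  by (subst pmf_expectation_bind[of "set_pmf p"]) (auto simp: integral_measure_pmf[of "set_pmf p"])

lemma expectation_mono_finite:
  fixes h1 h2 :: "'a \<Rightarrow> real"
  assumes "finite (set_pmf p)" "\<And>x. x \<in> set_pmf p \<Longrightarrow> h1 x \<le> h2 x"
  shows "measure_pmf.expectation p h1 \<le> measure_pmf.expectation p h2"
  using assms by (intro integral_mono_AE integrable_measure_pmf_finite) (auto simp: AE_measure_pmf_iff)

lemma expectation_cong_pmf:
  fixes h1 h2 :: "'a \<Rightarrow> real"
  assumes "\<And>x. x \<in> set_pmf p \<Longrightarrow> h1 x = h2 x"
  shows "measure_pmf.expectation p h1 = measure_pmf.expectation p h2"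
  using assms by (intro integral_cong_AE) (auto simp: AE_measure_pmf_iff)

lemma expectation_le_sqrt_second_moment:
  fixes h :: "'a \<Rightarrow> real"
  assumes "finite (set_pmf p)"
  shows "measure_pmf.expectation p h \<le> sqrt (measure_pmf.expectation p (\<lambda>x. (h x)\<^sup>2))"
proof (rule real_le_rsqrt)
  show "(measure_pmf.expectation p h)\<^sup>2 \<le> measure_pmf.expectation p (\<lambda>x. (h x)\<^sup>2)"
    using measure_pmf.variance_eq[of p h] measure_pmf.variance_positive[of p h] assms
    by (simp add: integrable_measure_pmf_finite)
qed

lemma finite_set_replicate_pmf:
  "finite (set_pmf p) \<Longrightarrow> finite (set_pmf (replicate_pmf k p))"
  by (induction k) auto

lemma expectation_replicate_pmf_Suc:
  fixes h :: "'a list \<Rightarrow> real"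
  assumes "finite (set_pmf p)"
  shows "measure_pmf.expectation (replicate_pmf (Suc k) p) h =
    measure_pmf.expectation p (\<lambda>x. measure_pmf.expectation (replicate_pmf k p) (\<lambda>xs. h (x # xs)))"
  using assms by (simp add: expectation_bind_finite finite_set_replicate_pmf)

text \<open>
  Redrawing one coordinate of an i.i.d. sample does not change its law.  This is the form in which
  conditional expectations given the past are used: for a fixed sample \<open>S\<close>, the inner expectation
  over the new entry \<open>B\<close> of \<open>S[k := B]\<close> averages over the \<open>k\<close>-th draw only, and everything that is
  determined by \<open>take k S\<close> is a constant in it.
\<close>
lemma expectation_replicate_pmf_resample:
  fixes h :: "'a list \<Rightarrow> real"
  assumes "finite (set_pmf p)" "k < N"
  shows "measure_pmf.expectation (replicate_pmf N p) h =
    measure_pmf.expectation (replicate_pmf N p)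
      (\<lambda>S. measure_pmf.expectation p (\<lambda>B. h (S[k := B])))"
  using assms(2)
proof (induction N arbitrary: k h)
  case (Suc N)
  show ?case
  proof (cases k)
    case 0
    have "measure_pmf.expectation (replicate_pmf (Suc N) p) h
      = measure_pmf.expectation (replicate_pmf N p \<bind> (\<lambda>xs. map_pmf (\<lambda>x. x # xs) p)) h"
      by (simp add: map_pmf_def bind_commute_pmf[of p])
    also have "\<dots> = measure_pmf.expectation (replicate_pmf N p)
        (\<lambda>xs. measure_pmf.expectation p (\<lambda>x. h (x # xs)))"
      using assms(1) by (subst expectation_bind_finite) (auto simp: finite_set_replicate_pmf)
    also have "\<dots> = measure_pmf.expectation (replicate_pmf (Suc N) p)
        (\<lambda>S. measure_pmf.expectation p (\<lambda>B. h (S[k := B])))"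
      using assms(1) 0 by (simp add: expectation_replicate_pmf_Suc del: replicate_pmf.simps)
    finally show ?thesis .
  next
    case (Suc m)
    then have "m < N"
      using Suc.prems by simp
    then show ?thesis
      unfolding expectation_replicate_pmf_Suc[OF assms(1)]
      using Suc.IH[of m "\<lambda>xs. h (x # xs)" for x] Suc
      by (intro expectation_cong_pmf[of p]) simp
  qed
qed simp

text \<open>
  Independent centered draws are uncorrelated, so the second moment of their sum is additive; \<open>v\<close> is
  an arbitrary deterministic shift, over which the induction on the batch size generalizes.
\<close>
lemma expectation_batch_second_moment:
  fixes c :: "nat \<Rightarrow> 'v::real_inner"
  assumes "1 \<le> n" "(\<Sum>i\<in>{1..n}. c i) = 0"
  shows "measure_pmf.expectation (replicate_pmf b (pmf_of_set {1..n}))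
      (\<lambda>B. (norm (v + (\<Sum>i\<leftarrow>B. c i)))\<^sup>2)
    = (norm v)\<^sup>2 + real b * ((\<Sum>i\<in>{1..n}. (norm (c i))\<^sup>2) / real n)"
proof (induction b arbitrary: v)
  case (Suc b)
  let ?m = "(\<Sum>i\<in>{1..n}. (norm (c i))\<^sup>2) / real n"
  have fin: "finite (set_pmf (pmf_of_set {1..n}))"
    using assms(1) by simp
  have "measure_pmf.expectation (replicate_pmf (Suc b) (pmf_of_set {1..n}))
      (\<lambda>B. (norm (v + (\<Sum>i\<leftarrow>B. c i)))\<^sup>2)
    = measure_pmf.expectation (pmf_of_set {1..n}) (\<lambda>i. (norm (v + c i))\<^sup>2 + real b * ?m)"
    unfolding expectation_replicate_pmf_Suc[OF fin]
    by (intro expectation_cong_pmf) (use Suc.IH[of "v + c i" for i] in \<open>simp add: add.assoc\<close>)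
  also have "\<dots> = (\<Sum>i\<in>{1..n}. (norm (v + c i))\<^sup>2 + real b * ?m) / real n"
    using assms(1) by (simp add: integral_pmf_of_set)
  also have "(\<Sum>i\<in>{1..n}. (norm (v + c i))\<^sup>2 + real b * ?m)
    = (\<Sum>i\<in>{1..n}. (norm v)\<^sup>2 + 2 * (v \<bullet> c i) + (norm (c i))\<^sup>2 + real b * ?m)"
    by (intro sum.cong refl) (simp add: power2_norm_eq_inner inner_add_left inner_add_right inner_commute)
  also have "\<dots> = real n * (norm v)\<^sup>2 + 2 * (v \<bullet> (\<Sum>i\<in>{1..n}. c i))
      + (\<Sum>i\<in>{1..n}. (norm (c i))\<^sup>2) + real n * (real b * ?m)"
    by (simp add: sum.distrib inner_sum_right sum_distrib_left)
  also have "\<dots> / real n = (norm v)\<^sup>2 + real (Suc b) * ?m"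
    unfolding assms(2) using assms(1) by (simp add: field_simps)
  finally show ?case .
qed simp

lemma sum_norm_minus_mean_le:
  fixes a :: "nat \<Rightarrow> 'v::real_inner" and n :: nat
  defines "m \<equiv> (1 / real n) *\<^sub>R (\<Sum>i\<in>{1..n}. a i)"
  assumes "1 \<le> n"
  shows "(\<Sum>i\<in>{1..n}. a i - m) = 0"
    and "(\<Sum>i\<in>{1..n}. (norm (a i - m))\<^sup>2) \<le> (\<Sum>i\<in>{1..n}. (norm (a i))\<^sup>2)"
proof -
  have m: "(\<Sum>i\<in>{1..n}. a i) = real n *\<^sub>R m"
    unfolding m_def using assms(2) by simp
  show "(\<Sum>i\<in>{1..n}. a i - m) = 0"
    unfolding sum_subtractf m by (simp add: sum_constant_scaleR)
  have "(\<Sum>i\<in>{1..n}. (norm (a i - m))\<^sup>2)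
      = (\<Sum>i\<in>{1..n}. (norm (a i))\<^sup>2 - 2 * (a i \<bullet> m) + (norm m)\<^sup>2)"
    by (intro sum.cong refl) (simp add: power2_norm_eq_inner inner_diff_left inner_diff_right inner_commute)
  also have "\<dots> = (\<Sum>i\<in>{1..n}. (norm (a i))\<^sup>2) - 2 * ((\<Sum>i\<in>{1..n}. a i) \<bullet> m) + real n * (norm m)\<^sup>2"
    by (simp add: sum.distrib sum_subtractf inner_sum_left sum_distrib_left)
  also have "\<dots> = (\<Sum>i\<in>{1..n}. (norm (a i))\<^sup>2) - real n * (norm m)\<^sup>2"
    unfolding m by (simp add: power2_norm_eq_inner)
  also have "\<dots> \<le> (\<Sum>i\<in>{1..n}. (norm (a i))\<^sup>2)"
    by simp
  finally show "(\<Sum>i\<in>{1..n}. (norm (a i - m))\<^sup>2) \<le> (\<Sum>i\<in>{1..n}. (norm (a i))\<^sup>2)" .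
qed

text \<open>
  The mean of a batch of \<open>b\<close> draws with replacement deviates from the full mean \<open>m\<close> by at most the
  mean square of the summands divided by \<open>b\<close>.
\<close>
lemma expectation_batch_mean_error:
  fixes a :: "nat \<Rightarrow> 'v::real_inner" and n :: nat
  defines "m \<equiv> (1 / real n) *\<^sub>R (\<Sum>i\<in>{1..n}. a i)"
  assumes "1 \<le> n" "1 \<le> b"
  shows "measure_pmf.expectation (replicate_pmf b (pmf_of_set {1..n}))
      (\<lambda>B. (norm (v + (1 / real b) *\<^sub>R (\<Sum>i\<leftarrow>B. a i - m)))\<^sup>2)
    \<le> (norm v)\<^sup>2 + (\<Sum>i\<in>{1..n}. (norm (a i))\<^sup>2) / real n / real b"
proof -
  let ?c = "\<lambda>i. (1 / real b) *\<^sub>R (a i - m)"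
  have scale: "(1 / real b) *\<^sub>R (\<Sum>i\<leftarrow>B. a i - m) = (\<Sum>i\<leftarrow>B. ?c i)" for B :: "nat list"
    by (induction B) (simp_all add: scaleR_add_right)
  have "(\<Sum>i\<in>{1..n}. ?c i) = 0"
    using sum_norm_minus_mean_le(1)[of n a] assms(2)
    by (simp add: m_def scaleR_sum_right[symmetric])
  then have "measure_pmf.expectation (replicate_pmf b (pmf_of_set {1..n}))
      (\<lambda>B. (norm (v + (1 / real b) *\<^sub>R (\<Sum>i\<leftarrow>B. a i - m)))\<^sup>2)
    = (norm v)\<^sup>2 + real b * ((\<Sum>i\<in>{1..n}. (norm (?c i))\<^sup>2) / real n)"
    unfolding scale using assms by (intro expectation_batch_second_moment)
  also have "(\<Sum>i\<in>{1..n}. (norm (?c i))\<^sup>2) = (\<Sum>i\<in>{1..n}. (norm (a i - m))\<^sup>2) / (real b)\<^sup>2"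
    by (simp add: power_divide sum_divide_distrib)
  also have "(norm v)\<^sup>2 + real b * ((\<Sum>i\<in>{1..n}. (norm (a i - m))\<^sup>2) / (real b)\<^sup>2 / real n)
    = (norm v)\<^sup>2 + (\<Sum>i\<in>{1..n}. (norm (a i - m))\<^sup>2) / real n / real b"
    using assms by (simp add: power2_eq_square)
  also have "\<dots> \<le> (norm v)\<^sup>2 + (\<Sum>i\<in>{1..n}. (norm (a i))\<^sup>2) / real n / real b"
    using sum_norm_minus_mean_le(2)[of n a] assms(2) 
    by (intro add_left_mono divide_right_mono) (auto simp: m_def)
  finally show ?thesis .
qed

lemma expectation_batch_not_drawn:
  assumes "i \<in> {1..n}"
  shows "measure_pmf.expectation (replicate_pmf b (pmf_of_set {1..n}))
      (\<lambda>B. if i \<in> set B then 0 else w) = (1 - 1 / real n) ^ b * w"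
proof (induction b)
  case (Suc b)
  have n: "1 \<le> n"
    using assms by simp
  then have fin: "finite (set_pmf (pmf_of_set {1..n}))"
    by simp
  have "measure_pmf.expectation (replicate_pmf (Suc b) (pmf_of_set {1..n}))
      (\<lambda>B. if i \<in> set B then 0 else w)
    = measure_pmf.expectation (pmf_of_set {1..n})
      (\<lambda>j. if j = i then 0 else (1 - 1 / real n) ^ b * w)"
    unfolding expectation_replicate_pmf_Suc[OF fin]
    using Suc.IH by (intro expectation_cong_pmf) auto
  also have "\<dots> = (\<Sum>j\<in>{1..n}. if j = i then 0 else (1 - 1 / real n) ^ b * w) / real n"
    using n by (simp add: integral_pmf_of_set)
  also have "(\<Sum>j\<in>{1..n}. if j = i then 0 else (1 - 1 / real n) ^ b * w)
    = (real n - 1) * ((1 - 1 / real n) ^ b * w)"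
    using assms by (simp add: sum.remove[of _ i] of_nat_diff)
  also have "\<dots> / real n = (1 - 1 / real n) ^ Suc b * w"
    using n by (simp add: field_simps)
  finally show ?case .
qed simp

section \<open>Scalar recursions\<close>

lemma one_minus_inverse_power_le:
  assumes "1 \<le> n"
  shows "(1 - 1 / real n) ^ b \<le> 1 / (1 + real b / real n)"
proof -
  have "(1 - 1 / real n) ^ b \<le> exp (- (1 / real n)) ^ b"
    using assms exp_ge_add_one_self[of "- (1 / real n)"] by (intro power_mono) auto
  also have "\<dots> = 1 / exp (real b / real n)"
    by (simp add: exp_of_nat_mult[symmetric] exp_minus field_simps)
  also have "\<dots> \<le> 1 / (1 + real b / real n)"
    by (intro divide_left_mono exp_ge_add_one_self) (auto intro!: mult_pos_pos add_pos_nonneg)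
  finally show ?thesis .
qed

text \<open>
  A quantity that contracts at rate \<open>5 p / 16\<close> while it is fed with \<open>W \<eta>\<^sub>k\<^sup>2\<close> stays of the order of
  \<open>\<eta>\<^sub>k\<^sup>2 / p\<close>, because \<open>\<eta>\<^sub>k\<^sup>2\<close> itself shrinks by a factor of at least \<open>1 - p / 4\<close> per step.
\<close>
lemma lyapunov_tracks_step_size:
  fixes \<Phi> \<eta> :: "nat \<Rightarrow> real"
  assumes p: "0 < p" "p \<le> 1" and W: "0 \<le> W" and "\<Phi> 0 \<le> 0"
    and rec: "\<And>k. k < N \<Longrightarrow> \<Phi> (Suc k) \<le> (1 - 5 * p / 16) * \<Phi> k + W * (\<eta> k)\<^sup>2"
    and \<eta>: "\<And>k. 0 \<le> \<eta> k" "\<And>k. (1 - p / 8) * \<eta> k \<le> \<eta> (Suc k)"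
    and "k \<le> N"
  shows "\<Phi> k \<le> 16 * W / p * (\<eta> k)\<^sup>2"
  using \<open>k \<le> N\<close>
proof (induction k)
  case 0
  have "0 \<le> 16 * W / p * (\<eta> 0)\<^sup>2"
    using p W by simp
  with \<open>\<Phi> 0 \<le> 0\<close> show ?case by linarith
next
  case (Suc k)
  have "\<Phi> (Suc k) \<le> (1 - 5 * p / 16) * \<Phi> k + W * (\<eta> k)\<^sup>2"
    using Suc.prems by (intro rec) simp
  also have "\<dots> \<le> (1 - 5 * p / 16) * (16 * W / p * (\<eta> k)\<^sup>2) + W * (\<eta> k)\<^sup>2"
    using Suc p by (intro add_right_mono mult_left_mono) auto
  also have "\<dots> = 16 * W / p * ((1 - p / 4) * (\<eta> k)\<^sup>2)"
    using p by (simp add: field_simps)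
  also have "\<dots> \<le> 16 * W / p * ((1 - p / 8) * \<eta> k)\<^sup>2"
  proof (rule mult_left_mono)
    have "1 - p / 4 \<le> (1 - p / 8)\<^sup>2"
      by (simp add: power2_eq_square algebra_simps)
    then show "(1 - p / 4) * (\<eta> k)\<^sup>2 \<le> ((1 - p / 8) * \<eta> k)\<^sup>2"
      by (simp add: power_mult_distrib mult_right_mono)
  qed (use p W in simp)
  also have "\<dots> \<le> 16 * W / p * (\<eta> (Suc k))\<^sup>2"
    using p W \<eta>[of k] by (intro mult_left_mono power_mono) auto
  finally show ?case .
qed

section \<open>The step sizes and the resulting rate\<close>

text \<open>
  The step sizes never exceed \<open>b / (4 n)\<close>, and each is at least \<open>1 - b / (8 n)\<close> times its
  predecessor, also where the constant phase is followed by the decreasing one: the first decreasing step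
  size \<open>2 / (8 n / b)\<close> is again \<open>b / (4 n)\<close>.
\<close>
lemma step_size_bounds:
  assumes "1 \<le> b" "b \<le> n"
  shows "0 < step_size n b K k" "step_size n b K k \<le> real b / (4 * real n)"
    and "(1 - real b / real n / 8) * step_size n b K k \<le> step_size n b K (Suc k)"
proof -
  define a where "a = 8 * real n / real b"
  have a: "8 \<le> a" and p: "real b / (4 * real n) = 2 / a" and p8: "real b / real n / 8 = 1 / a"
    using assms by (simp_all add: a_def field_simps)
  show "0 < step_size n b K k" "step_size n b K k \<le> real b / (4 * real n)"
    unfolding step_size_def a_def[symmetric] p using a
    by (auto intro!: divide_pos_pos divide_left_mono mult_pos_pos)
  have const: "(1 - 1 / a) * (2 / a) \<le> 2 / a"
    using a by (simp add: field_simps)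
  consider "real K \<le> 4 * real n / real b \<or> int (Suc k) < \<lceil>real K / 2\<rceil>"
    | "\<not> real K \<le> 4 * real n / real b" "int (Suc k) = \<lceil>real K / 2\<rceil>"
    | "\<not> real K \<le> 4 * real n / real b" "\<lceil>real K / 2\<rceil> \<le> int k"
    by linarith
  then show "(1 - real b / real n / 8) * step_size n b K k \<le> step_size n b K (Suc k)"
  proof cases
    case 1
    then show ?thesis
      unfolding step_size_def a_def[symmetric] p p8 using const by auto
  next
    case 2
    then have "real_of_int \<lceil>real K / 2\<rceil> = real (Suc k)"
      by linarith
    with 2 show ?thesis
      unfolding step_size_def a_def[symmetric] p p8 using const by auto
  next
    case 3
    define t where "t = real k - of_int \<lceil>real K / 2\<rceil>"
    have t: "0 \<le> t"
      using 3 unfolding t_def by linarith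
    have "1 / (a + t + 1) \<le> 1 / a"
      using a t by (intro divide_left_mono mult_pos_pos) auto
    moreover have "(a + t) / (a + t + 1) = 1 - 1 / (a + t + 1)"
      using a t by (simp add: field_simps)
    ultimately have "(1 - 1 / a) * (2 / (a + t)) \<le> (a + t) / (a + t + 1) * (2 / (a + t))"
      using a t by (intro mult_right_mono) auto
    also have "\<dots> = 2 / (a + t + 1)"
    proof -
      have "z / c * (2 / z) = 2 / c" if "z \<noteq> 0" for z c :: real
        using that by simp
      from this[of "a + t"] show ?thesis
        using a t by simp
    qed
    finally have "(1 - 1 / a) * (2 / (a + t)) \<le> 2 / (a + t + 1)" .
    moreover have "step_size n b K k = 2 / (a + t)" "step_size n b K (Suc k) = 2 / (a + t + 1)"
      using 3 unfolding step_size_def a_def[symmetric] t_def by (auto simp: algebra_simps)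
    ultimately show ?thesis
      unfolding p8 by simp
  qed
qed

lemma constant_step_rate:
  fixes F :: "nat \<Rightarrow> real"
  assumes c: "0 \<le> c" "c \<le> 1" and "0 \<le> F 0" "0 \<le> M"
    and rec: "\<And>k. k < m \<Longrightarrow> F (Suc k) \<le> (1 - c) * F k + M * c\<^sup>2"
  shows "F m \<le> F 0 * exp (- (c * real m)) + M * c"
proof -
  have "F k \<le> (1 - c) ^ k * F 0 + M * c" if "k \<le> m" for k
    using that
  proof (induction k)
    case (Suc k)
    have "F (Suc k) \<le> (1 - c) * F k + M * c\<^sup>2"
      using Suc.prems by (intro rec) simp
    also have "\<dots> \<le> (1 - c) * ((1 - c) ^ k * F 0 + M * c) + M * c\<^sup>2"
      using Suc c by (intro add_right_mono mult_left_mono) auto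
    also have "\<dots> = (1 - c) ^ Suc k * F 0 + M * c"
      by (simp add: algebra_simps power2_eq_square)
    finally show ?case .
  qed (use c assms in simp)
  then have "F m \<le> (1 - c) ^ m * F 0 + M * c"
    by simp
  also have "(1 - c) ^ m \<le> exp (- c) ^ m"
    using c exp_ge_add_one_self[of "- c"] by (intro power_mono) auto
  also have "exp (- c) ^ m = exp (- (c * real m))"
    by (simp add: exp_of_nat_mult[symmetric] mult.commute)
  finally show ?thesis
    using assms(3) by (simp add: mult_right_mono mult.commute)
qed

text \<open>
  With step sizes \<open>2 / (a + j)\<close>, the weights \<open>(a + j - 1) (a + j - 2)\<close> turn the recursion into one
  whose increments are bounded by \<open>4 M\<close>.
\<close>
lemma harmonic_step_rate:
  fixes G :: "nat \<Rightarrow> real"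
  assumes a: "2 \<le> a" and M: "0 \<le> M"
    and rec: "\<And>j. j < J \<Longrightarrow> G (Suc j) \<le> (1 - 2 / (a + real j)) * G j + M * (2 / (a + real j))\<^sup>2"
    and "j \<le> J"
  shows "(a + real j - 1) * (a + real j - 2) * G j \<le> (a - 1) * (a - 2) * G 0 + 4 * M * real j"
  using \<open>j \<le> J\<close>
proof (induction j)
  case (Suc j)
  define z where "z = a + real j"
  have z: "2 \<le> z"
    using a by (simp add: z_def)
  have "z * (z - 1) * G (Suc j) \<le> z * (z - 1) * ((1 - 2 / z) * G j + M * (2 / z)\<^sup>2)"
    using rec[of j] Suc.prems z by (intro mult_left_mono) (auto simp: z_def)
  also have "\<dots> = (z - 1) * (z - 2) * G j + 4 * M * ((z - 1) / z)"
    using z by (simp add: field_simps power2_eq_square)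
  also have "\<dots> \<le> ((a - 1) * (a - 2) * G 0 + 4 * M * real j) + 4 * M * 1"
    using Suc z M by (intro add_mono mult_left_mono) (auto simp: z_def)
  finally show ?case
    by (simp add: z_def algebra_simps)
qed simp

text \<open>
  The constant phase makes the initial error decay geometrically down to a floor \<open>M b / (4 n)\<close>,
  which is already at most \<open>M / K\<close> if \<open>K \<le> 4 n / b\<close>.  Otherwise this phase takes half of the steps,
  and the second half reduces the floor to order \<open>M / K\<close> while increasing the remaining initial error by
  at most a constant factor.
\<close>
lemma step_size_rate:
  fixes F :: "nat \<Rightarrow> real"
  assumes b: "1 \<le> b" "b \<le> n" and K: "1 \<le> K" and F0: "0 \<le> F 0" and M: "0 \<le> M"
    and rec: "\<And>k. k < K \<Longrightarrow>
      F (Suc k) \<le> (1 - step_size n b K k) * F k + M * (step_size n b K k)\<^sup>2"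
  shows "F K \<le> 2 * (F 0 * exp (- (real b * real K / (8 * real n)))) + 22 * M / real K"
proof -
  \<comment> \<open>The offset \<open>a\<close> of the decreasing phase also governs the constant one: \<open>b / (4 n) = 2 / a\<close>.\<close>
  define a where "a = 8 * real n / real b"
  define E where "E = exp (- (real b * real K / (8 * real n)))"
  have a: "8 \<le> a" and p: "real b / (4 * real n) = 2 / a" and pK: "4 * real n / real b = a / 2"
    and E: "E = exp (- (real K / a))"
    using b by (simp_all add: a_def E_def field_simps)
  have \<eta>: "step_size n b K k =
     (if real K \<le> a / 2 then 2 / a
      else if int k < \<lceil>real K / 2\<rceil> then 2 / a
      else 2 / (a + real k - of_int \<lceil>real K / 2\<rceil>))" for k
    unfolding step_size_def a_def[symmetric] p pK ..
  have "F K \<le> 2 * (F 0 * E) + 22 * M / real K"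
  proof (cases "real K \<le> a / 2")
    case True
    then have "step_size n b K k = 2 / a" for k
      by (simp add: \<eta>)
    then have "F K \<le> F 0 * exp (- (2 / a * real K)) + M * (2 / a)"
      using rec a F0 M by (intro constant_step_rate) auto
    also have "\<dots> \<le> F 0 * E + M * (1 / real K)"
      using True a K F0 M unfolding E
      by (intro add_mono mult_left_mono) (auto simp: field_simps)
    also have "\<dots> \<le> 2 * (F 0 * E) + 22 * M / real K"
      using F0 M K by (intro add_mono) (auto simp: E divide_right_mono)
    finally show ?thesis .
  next
    case False
    define m where "m = nat \<lceil>real K / 2\<rceil>"
    have m: "real m = of_int \<lceil>real K / 2\<rceil>"
      by (simp add: m_def)
    have mK: "real K / 2 \<le> real m" "real m < real K / 2 + 1" "m \<le> K"
      unfolding m m_def using K by linarith+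
    define J where "J = K - m"
    define z where "z = a + real J"
    have J: "real J = real K - real m"
      using mK by (simp add: J_def)
    have z: "8 \<le> z" "real K / 2 \<le> z" "a \<le> z" "real J \<le> z"
      using mK a unfolding z_def J by linarith+
    have \<eta>1: "step_size n b K k = 2 / a" if "k < m" for k
      using that False by (auto simp: \<eta> m_def)
    have \<eta>2: "step_size n b K (m + j) = 2 / (a + real j)" for j
      using False unfolding \<eta> by (auto simp: m_def)
    have "F m \<le> F 0 * exp (- (2 / a * real m)) + M * (2 / a)"
      using rec mK a F0 M
      by (intro constant_step_rate) (auto simp: \<eta>1[symmetric])
    also have "\<dots> \<le> F 0 * E + M * (2 / a)"
      using mK a F0 M unfolding E
      by (intro add_mono mult_left_mono) (auto simp: field_simps)
    finally have Fm: "F m \<le> F 0 * E + M * (2 / a)" .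
    have "(z - 1) * (z - 2) * F K \<le> (a - 1) * (a - 2) * F m + 4 * M * real J"
    proof -
      have "(a + real J - 1) * (a + real J - 2) * F (m + J)
          \<le> (a - 1) * (a - 2) * F (m + 0) + 4 * M * real J"
      proof (rule harmonic_step_rate[where G = "\<lambda>j. F (m + j)" and J = J])
        fix j assume "j < J"
        then show "F (m + Suc j)
            \<le> (1 - 2 / (a + real j)) * F (m + j) + M * (2 / (a + real j))\<^sup>2"
          using rec[of "m + j"] by (simp add: \<eta>2 J_def)
      qed (use a M in auto)
      then show ?thesis
        using mK by (simp add: z_def J_def)
    qed
    also have "\<dots> \<le> (a - 1) * (a - 2) * (F 0 * E + M * (2 / a)) + 4 * M * z"
      using a M z Fm by (intro add_mono mult_left_mono) auto
    also have "\<dots> \<le> a\<^sup>2 * (F 0 * E + M * (2 / a)) + 4 * M * z"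
      using a F0 M
      by (intro add_right_mono mult_right_mono add_nonneg_nonneg)
        (auto simp: E power2_eq_square algebra_simps)
    also have "\<dots> = a\<^sup>2 * (F 0 * E) + 2 * M * a + 4 * M * z"
      using a by (simp add: power2_eq_square field_simps)
    also have "\<dots> \<le> z\<^sup>2 * (F 0 * E) + 2 * M * z + 4 * M * z"
      using a z F0 M by (intro add_mono mult_left_mono mult_right_mono power_mono) (auto simp: E)
    also have "\<dots> = z\<^sup>2 * (F 0 * E + 6 * M / z)"
      using z by (simp add: power2_eq_square field_simps)
    finally have main: "(z - 1) * (z - 2) * F K \<le> z\<^sup>2 * (F 0 * E + 6 * M / z)" .
    \<comment> \<open>Since \<open>z \<ge> 8\<close>, the weight \<open>(z - 1) (z - 2)\<close> loses only a constant factor against \<open>z\<^sup>2\<close>.\<close>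
    have w: "z\<^sup>2 \<le> 16 / 9 * ((z - 1) * (z - 2))"
    proof -
      have "8 * z \<le> z * z"
        using z by (intro mult_right_mono) auto
      moreover have "16 / 9 * ((z - 1) * (z - 2)) = 16 / 9 * (z * z) - 16 / 3 * z + 32 / 9"
        by (simp add: field_simps)
      ultimately show ?thesis
        using z(1) unfolding power2_eq_square by linarith
    qed
    have "0 \<le> F 0 * E + 6 * M / z"
      using F0 M z by (simp add: E)
    then have "(z - 1) * (z - 2) * F K \<le> 16 / 9 * ((z - 1) * (z - 2)) * (F 0 * E + 6 * M / z)"
      using main w by (meson mult_right_mono order_trans)
    also have "\<dots> = (z - 1) * (z - 2) * (16 / 9 * (F 0 * E + 6 * M / z))"
      by simp
    finally have "F K \<le> 16 / 9 * (F 0 * E + 6 * M / z)"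
      using z by (subst (asm) mult_le_cancel_left_pos) auto
    also have "\<dots> \<le> 16 / 9 * (F 0 * E + 6 * M / (real K / 2))"
      using z M K by (intro mult_left_mono add_left_mono divide_left_mono mult_pos_pos) auto
    also have "\<dots> \<le> 2 * (F 0 * E) + 22 * M / real K"
    proof -
      have "16 / 9 * (F 0 * E) \<le> 2 * (F 0 * E)"
        using F0 by (intro mult_right_mono) (auto simp: E)
      moreover have "16 / 9 * (6 * M / (real K / 2)) \<le> 22 * M / real K"
        using M K by (simp add: field_simps)
      ultimately show ?thesis
        by (simp only: distrib_left)
    qed
    finally show ?thesis .
  qed
  then show ?thesis
    by (simp add: E_def)
qed

section \<open>Runs of the algorithm\<close>

lemma power2_norm_add_le_young:
  fixes u v :: "'v::real_inner"
  assumes "0 < \<beta>"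
  shows "(norm (u + v))\<^sup>2 \<le> (1 + \<beta>) * (norm u)\<^sup>2 + (1 + 1 / \<beta>) * (norm v)\<^sup>2"
proof -
  have "(norm (u + v))\<^sup>2 \<le> (norm u + norm v)\<^sup>2"
    by (intro power_mono norm_triangle_ineq norm_ge_zero)
  also have "\<dots> \<le> (norm u)\<^sup>2 + (norm v)\<^sup>2 + (\<beta> * (norm u)\<^sup>2 + (norm v)\<^sup>2 / \<beta>)"
  proof -
    have "0 \<le> (\<beta> * norm u - norm v)\<^sup>2 / \<beta>"
      using assms by simp
    also have "\<dots> = \<beta> * (norm u)\<^sup>2 + (norm v)\<^sup>2 / \<beta> - 2 * norm u * norm v"
      using assms by (simp add: field_simps power2_eq_square)
    finally show ?thesis
      by (simp add: power2_sum)
  qed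
  also have "\<dots> = (1 + \<beta>) * (norm u)\<^sup>2 + (1 + 1 / \<beta>) * (norm v)\<^sup>2"
    using assms by (simp add: field_simps)
  finally show ?thesis .
qed

text \<open>
  A run of the algorithm with momentum \<open>b / (2 n)\<close> on a convex problem.  The step sizes \<open>\<eta>\<close> are left
  open: they have to be positive, at most \<open>b / (4 n)\<close>, and each of them has to be at least
  \<open>1 - b / (8 n)\<close> times its predecessor.
\<close>
locale saga_sarah_run =
  fixes d n b K :: nat and X :: "vec set" and f :: "nat \<Rightarrow> vec \<Rightarrow> real"
    and L :: real and Li :: "nat \<Rightarrow> real" and D :: real and x0 xstar :: vec
    and \<eta> :: "nat \<Rightarrow> real" and s :: "nat list list \<Rightarrow> vec"
    and x g :: "nat \<Rightarrow> nat list list \<Rightarrow> vec" and y :: "nat \<Rightarrow> nat list list \<Rightarrow> nat \<Rightarrow> vec"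
  assumes b: "1 \<le> b" "b \<le> n"
    and X_subset: "X \<subseteq> Rd d" and X_convex: "convex X"
    and D_pos: "0 < D" and diameter: "\<And>u v. u \<in> X \<Longrightarrow> v \<in> X \<Longrightarrow> norm (u - v) \<le> D"
    and diff: "\<And>i. i \<in> {1..n} \<Longrightarrow> differentiable_near d X (f i)"
    and L_pos: "0 < L" and L_smooth: "smooth_on d X L (avg n f)"
    and Li_smooth: "\<And>i. i \<in> {1..n} \<Longrightarrow> smooth_on d X (Li i) (f i)"
    and grad_convex: "grad_convex_on d X (avg n f)"
    and xstar: "is_arg_min (avg n f) (\<lambda>u. u \<in> X) xstar"
    and x0: "x0 \<in> X"
    and \<eta>_pos: "\<And>k. 0 < \<eta> k" and \<eta>_le: "\<And>k. \<eta> k \<le> real b / (4 * real n)"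
    and \<eta>_decay: "\<And>k. (1 - real b / real n / 8) * \<eta> k \<le> \<eta> (Suc k)"
    and run: "saga_sarah_fw d X n f b (real b / (2 * real n)) \<eta> K x0 s x g y"
begin

text \<open>
  \<open>Q\<close> is the law of one batch, \<open>P\<close> that of all \<open>K\<close> batches; \<open>Gavg\<close> and \<open>G i\<close> are the gradients of the
  objective and of its \<open>i\<close>-th component.
\<close>
abbreviation "Q \<equiv> replicate_pmf b (pmf_of_set {1..n})"
abbreviation "P \<equiv> batches_pmf n b K"
abbreviation "Gavg \<equiv> grad d (avg n f)"
abbreviation "G i \<equiv> grad d (f i)"

text \<open>The expected number of times that a given index is drawn in one batch.\<close>

definition p :: real where "p = real b / real n"

text \<open>The mean of the squared smoothness constants of the components.\<close>

definition mean_sq_L :: real where "mean_sq_L = (\<Sum>i\<in>{1..n}. (Li i)\<^sup>2) / real n"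

text \<open>The error of the gradient estimator after \<open>k\<close> steps.\<close>

definition err :: "nat \<Rightarrow> nat list list \<Rightarrow> vec"
  where "err k S = g k S - Gavg (x k S)"

text \<open>The mean square distance of the stored gradients from the current ones.\<close>

definition staleness :: "nat \<Rightarrow> nat list list \<Rightarrow> real"
  where "staleness k S = (\<Sum>i\<in>{1..n}. (norm (G i (x k S) - y k S i))\<^sup>2) / real n"

lemma n_pos: "1 \<le> n"
  using b by linarith

lemma p_bounds: "0 < p" "p \<le> 1"
  using b by (auto simp: p_def)

lemma mean_sq_L_nonneg: "0 \<le> mean_sq_L"
  by (simp add: mean_sq_L_def sum_nonneg)

lemma finite_uniform: "finite (set_pmf (pmf_of_set {1..n}))"
  using n_pos by simp

lemma finite_Q: "finite (set_pmf Q)"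
  using finite_uniform by (rule finite_set_replicate_pmf)

lemma finite_P: "finite (set_pmf P)"
  unfolding batches_pmf_def using finite_Q by (rule finite_set_replicate_pmf)

lemma in_Q_D:
  assumes "B \<in> set_pmf Q"
  shows "length B = b" "set B \<subseteq> {1..n}"
  using assms n_pos by (auto simp: set_replicate_pmf)

lemma in_P_iff: "S \<in> set_pmf P \<longleftrightarrow> length S = K \<and> (\<forall>B\<in>set S. B \<in> set_pmf Q)"
  unfolding batches_pmf_def by (auto simp: set_replicate_pmf[of K])

lemma resample_in_P:
  assumes "S \<in> set_pmf P" "B \<in> set_pmf Q"
  shows "S[k := B] \<in> set_pmf P"
  using assms set_update_subset_insert[of S k B] unfolding in_P_iff by fastforce

lemma batch_in_Q:
  assumes "S \<in> set_pmf P" "k < K"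
  shows "S ! k \<in> set_pmf Q"
  using assms unfolding in_P_iff by auto

lemma init:
  assumes "S \<in> set_pmf P"
  shows "x 0 S = x0" "g 0 S = Gavg x0" "\<And>i. i \<in> {1..n} \<Longrightarrow> y 0 S i = G i x0"
  using run assms unfolding saga_sarah_fw_def by blast+

lemma step:
  assumes "S \<in> set_pmf P" "k < K"
  shows "is_arg_min (\<lambda>u. g k S \<bullet> u) (\<lambda>u. u \<in> X) (s (take k S))"
    and "x (Suc k) S = x k S + \<eta> k *\<^sub>R (s (take k S) - x k S)"
    and "g (Suc k) S =
          (1 / real b) *\<^sub>R (\<Sum>i\<leftarrow>S ! k. G i (x (Suc k) S) - G i (x k S))
          + (1 - real b / (2 * real n)) *\<^sub>R g k S
          + (real b / (2 * real n)) *\<^sub>R ((1 / real b) *\<^sub>R (\<Sum>i\<leftarrow>S ! k. G i (x k S) - y k S i)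
                     + (1 / real n) *\<^sub>R (\<Sum>j\<in>{1..n}. y k S j))"
    and "\<And>i. i \<in> {1..n} \<Longrightarrow>
      y (Suc k) S i = (if i \<in> set (S ! k) then G i (x (Suc k) S) else y k S i)"
  using run assms unfolding saga_sarah_fw_def by blast+

lemma s_in_X:
  assumes "S \<in> set_pmf P" "k < K"
  shows "s (take k S) \<in> X"
  using step(1)[OF assms] by (simp add: is_arg_min_def)

lemma x_in_X:
  assumes "S \<in> set_pmf P" "k \<le> K"
  shows "x k S \<in> X"
  using assms(2)
proof (induction k)
  case 0
  show ?case
    using init(1)[OF assms(1)] x0 by simp
next
  case (Suc k)
  have "real b / (4 * real n) \<le> 1"
    using b by simp
  then have "\<eta> k \<le> 1"
    using \<eta>_le[of k] by linarith
  then have "(1 - \<eta> k) *\<^sub>R x k S + \<eta> k *\<^sub>R s (take k S) \<in> X"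
    using Suc \<eta>_pos[of k] s_in_X[OF assms(1)] by (intro convexD[OF X_convex]) auto
  also have "(1 - \<eta> k) *\<^sub>R x k S + \<eta> k *\<^sub>R s (take k S)
      = x k S + \<eta> k *\<^sub>R (s (take k S) - x k S)"
    by (simp add: algebra_simps)
  also have "\<dots> = x (Suc k) S"
    using step(2)[OF assms(1), of k] Suc.prems by simp
  finally show ?case .
qed

lemma norm_step_le:
  assumes "S \<in> set_pmf P" "k < K"
  shows "norm (x (Suc k) S - x k S) \<le> \<eta> k * D"
proof -
  have "norm (x (Suc k) S - x k S) = \<eta> k * norm (s (take k S) - x k S)"
    using step(2)[OF assms] \<eta>_pos[of k] by simp
  also have "\<dots> \<le> \<eta> k * D"
    using diameter[OF s_in_X[OF assms] x_in_X[OF assms(1)]] assms(2) \<eta>_pos[of k]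
    by (intro mult_left_mono) auto
  finally show ?thesis .
qed

text \<open>
  The functions \<open>x k\<close>, \<open>g k\<close> and \<open>y k\<close> take the whole sample as argument, but only its first \<open>k\<close>
  batches matter.
\<close>
lemma determined_by_past:
  assumes "S \<in> set_pmf P" "S' \<in> set_pmf P" "k \<le> K" "take k S = take k S'"
  shows "x k S = x k S' \<and> g k S = g k S' \<and> (\<forall>i\<in>{1..n}. y k S i = y k S' i)"
  using assms(3,4)
proof (induction k)
  case 0
  show ?case
    using init[OF assms(1)] init[OF assms(2)] by simp
next
  case (Suc k)
  have k: "k < K" "k \<le> K"
    using Suc.prems by auto
  have past: "take k S = take k S'"
    using arg_cong[OF Suc.prems(2), of "take k"] by simp
  have batch: "S ! k = S' ! k"
    using arg_cong[OF Suc.prems(2), of "\<lambda>T. T ! k"] by simp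
  note IH = Suc.IH[OF k(2) past]
  have xS: "x (Suc k) S = x (Suc k) S'"
    using step(2)[OF assms(1) k(1)] step(2)[OF assms(2) k(1)] IH past by simp
  have "set (S' ! k) \<subseteq> {1..n}"
    using batch_in_Q[OF assms(2) k(1)] in_Q_D by blast
  then have "(\<Sum>i\<leftarrow>S ! k. G i (x k S) - y k S i) = (\<Sum>i\<leftarrow>S' ! k. G i (x k S') - y k S' i)"
    using IH batch by (intro arg_cong[where f = sum_list] map_cong) auto
  moreover have "(\<Sum>j\<in>{1..n}. y k S j) = (\<Sum>j\<in>{1..n}. y k S' j)"
    using IH by (intro sum.cong) auto
  ultimately have "g (Suc k) S = g (Suc k) S'"
    unfolding step(3)[OF assms(1) k(1)] step(3)[OF assms(2) k(1)] using IH xS batch by simp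
  moreover have "\<forall>i\<in>{1..n}. y (Suc k) S i = y (Suc k) S' i"
    using step(4)[OF assms(1) k(1)] step(4)[OF assms(2) k(1)] IH xS batch by simp
  ultimately show ?case
    using xS by blast
qed

text \<open>
  Hence redrawing batch \<open>k\<close> leaves the state after \<open>k\<close> steps unchanged.  The next iterate does not
  change either, since it is computed before batch \<open>k\<close> is used.
\<close>
lemma resample:
  assumes "S \<in> set_pmf P" "B \<in> set_pmf Q" "k < K"
  shows "x k (S[k := B]) = x k S" "g k (S[k := B]) = g k S"
    and "\<And>i. i \<in> {1..n} \<Longrightarrow> y k (S[k := B]) i = y k S i"
    and "x (Suc k) (S[k := B]) = x (Suc k) S"
    and "S[k := B] ! k = B"
proof -
  note S' = resample_in_P[OF assms(1,2), of k]
  show "x k (S[k := B]) = x k S" "g k (S[k := B]) = g k S"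
    and "\<And>i. i \<in> {1..n} \<Longrightarrow> y k (S[k := B]) i = y k S i"
    using determined_by_past[OF S' assms(1), of k] assms(3) by auto
  then show "x (Suc k) (S[k := B]) = x (Suc k) S"
    using step(2)[OF assms(1,3)] step(2)[OF S' assms(3)] by simp
  show "S[k := B] ! k = B"
    using assms by (simp add: in_P_iff)
qed

lemma expectation_resample:
  fixes h :: "nat list list \<Rightarrow> real"
  assumes "k < K"
  shows "measure_pmf.expectation P h
    = measure_pmf.expectation P (\<lambda>S. measure_pmf.expectation Q (\<lambda>B. h (S[k := B])))"
  unfolding batches_pmf_def using finite_Q assms by (rule expectation_replicate_pmf_resample)

lemma differentiable_in_X:
  assumes "u \<in> X" "i \<in> {1..n}"
  shows "f i differentiable (at u within Rd d)"
  using diff assms by (blast intro: differentiable_nearD)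

lemma avg_differentiable_in_X:
  assumes "u \<in> X"
  shows "avg n f differentiable (at u within Rd d)"
  using assms X_subset differentiable_in_X by (intro grad_avg(2)) auto

lemma grad_avg_in_X:
  assumes "u \<in> X"
  shows "Gavg u = (1 / real n) *\<^sub>R (\<Sum>i\<in>{1..n}. G i u)"
  using assms X_subset differentiable_in_X by (intro grad_avg(1)) auto

lemma mean_sq_gradient_change:
  assumes "S \<in> set_pmf P" "k < K"
  shows "(\<Sum>i\<in>{1..n}. (norm (G i (x (Suc k) S) - G i (x k S)))\<^sup>2) / real n
    \<le> mean_sq_L * D\<^sup>2 * (\<eta> k)\<^sup>2"
proof -
  have "(norm (G i (x (Suc k) S) - G i (x k S)))\<^sup>2 \<le> (Li i)\<^sup>2 * (D\<^sup>2 * (\<eta> k)\<^sup>2)"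
    if "i \<in> {1..n}" for i
  proof -
    have "norm (G i (x (Suc k) S) - G i (x k S)) \<le> Li i * norm (x (Suc k) S - x k S)"
      using Li_smooth[OF that] x_in_X[OF assms(1)] assms(2) by (simp add: smooth_on_def)
    then have "(norm (G i (x (Suc k) S) - G i (x k S)))\<^sup>2
        \<le> (Li i * norm (x (Suc k) S - x k S))\<^sup>2"
      by (intro power_mono) auto
    also have "\<dots> = (Li i)\<^sup>2 * (norm (x (Suc k) S - x k S))\<^sup>2"
      by (rule power_mult_distrib)
    also have "\<dots> \<le> (Li i)\<^sup>2 * (\<eta> k * D)\<^sup>2"
      using norm_step_le[OF assms] by (intro mult_left_mono power_mono) auto
    finally show ?thesis
      by (simp add: power_mult_distrib mult.commute)
  qed
  then have "(\<Sum>i\<in>{1..n}. (norm (G i (x (Suc k) S) - G i (x k S)))\<^sup>2)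
      \<le> (\<Sum>i\<in>{1..n}. (Li i)\<^sup>2) * (D\<^sup>2 * (\<eta> k)\<^sup>2)"
    unfolding sum_distrib_right by (rule sum_mono)
  then show ?thesis
    using n_pos by (simp add: mean_sq_L_def divide_right_mono field_simps)
qed

text \<open>
  Conditionally on the past, the new error is \<open>1 - p / 2\<close> times the old one plus the centered mean over
  the batch of \<open>a i\<close>, the change of the \<open>i\<close>-th gradient plus \<open>p / 2\<close> times its staleness.  The two
  parts are orthogonal in the mean, so that no cross term appears.
\<close>
lemma err_step:
  assumes S: "S \<in> set_pmf P" and k: "k < K"
  shows "measure_pmf.expectation Q (\<lambda>B. (norm (err (Suc k) (S[k := B])))\<^sup>2)
    \<le> (1 - 3 * p / 4) * (norm (err k S))\<^sup>2
      + 2 / real b * (mean_sq_L * D\<^sup>2 * (\<eta> k)\<^sup>2) + p\<^sup>2 / (2 * real b) * staleness k S"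
proof -
  have lam: "real b / (2 * real n) = p / 2"
    by (simp add: p_def)
  let ?\<Delta> = "\<lambda>i. G i (x (Suc k) S) - G i (x k S)"
  let ?\<sigma> = "\<lambda>i. G i (x k S) - y k S i"
  define a where "a i = ?\<Delta> i + (p / 2) *\<^sub>R ?\<sigma> i" for i
  define m where "m = (1 / real n) *\<^sub>R (\<Sum>i\<in>{1..n}. a i)"
  have xX: "x k S \<in> X" "x (Suc k) S \<in> X"
    using x_in_X[OF S] k by auto
  have m: "m = (Gavg (x (Suc k) S) - Gavg (x k S))
      + (p / 2) *\<^sub>R (Gavg (x k S) - (1 / real n) *\<^sub>R (\<Sum>j\<in>{1..n}. y k S j))"
    unfolding m_def a_def grad_avg_in_X[OF xX(1)] grad_avg_in_X[OF xX(2)]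
    by (simp add: sum.distrib sum_subtractf scaleR_sum_right[symmetric] scaleR_add_right scaleR_diff_right
        mult.commute)
  have err: "err (Suc k) (S[k := B])
      = (1 - p / 2) *\<^sub>R err k S + (1 / real b) *\<^sub>R (\<Sum>i\<leftarrow>B. a i - m)"
    if B: "B \<in> set_pmf Q" for B
  proof -
    note S' = resample_in_P[OF S B, of k]
    note r = resample[OF S B k]
    have split: "(\<Sum>i\<leftarrow>B'. a i - m)
        = (\<Sum>i\<leftarrow>B'. ?\<Delta> i) + (p / 2) *\<^sub>R (\<Sum>i\<leftarrow>B'. ?\<sigma> i) - real (length B') *\<^sub>R m" for B'
      by (induction B') (simp_all add: a_def scaleR_add_left scaleR_add_right)
    have batch: "(1 / real b) *\<^sub>R (\<Sum>i\<leftarrow>B. a i - m)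
        = (1 / real b) *\<^sub>R (\<Sum>i\<leftarrow>B. ?\<Delta> i) + (p / 2) *\<^sub>R ((1 / real b) *\<^sub>R (\<Sum>i\<leftarrow>B. ?\<sigma> i)) - m"
      using b in_Q_D(1)[OF B] by (simp add: split scaleR_add_right scaleR_diff_right)
    have "(\<Sum>i\<leftarrow>B. G i (x k S) - y k (S[k := B]) i) = (\<Sum>i\<leftarrow>B. ?\<sigma> i)"
      using r(3) in_Q_D(2)[OF B] by (intro arg_cong[where f = sum_list] map_cong) auto
    moreover have "(\<Sum>j\<in>{1..n}. y k (S[k := B]) j) = (\<Sum>j\<in>{1..n}. y k S j)"
      using r(3) by (intro sum.cong) auto
    ultimately have "g (Suc k) (S[k := B]) = (1 / real b) *\<^sub>R (\<Sum>i\<leftarrow>B. ?\<Delta> i) + (1 - p / 2) *\<^sub>R g k S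
        + (p / 2) *\<^sub>R ((1 / real b) *\<^sub>R (\<Sum>i\<leftarrow>B. ?\<sigma> i)
          + (1 / real n) *\<^sub>R (\<Sum>j\<in>{1..n}. y k S j))"
      unfolding step(3)[OF S' k] r lam by simp
    then show ?thesis
      unfolding err_def r(4) batch unfolding m by (simp add: algebra_simps)
  qed
  have mean_a: "(\<Sum>i\<in>{1..n}. (norm (a i))\<^sup>2) / real n
      \<le> 2 * (mean_sq_L * D\<^sup>2 * (\<eta> k)\<^sup>2) + p\<^sup>2 / 2 * staleness k S"
  proof -
    have "(norm (a i))\<^sup>2 \<le> 2 * (norm (?\<Delta> i))\<^sup>2 + p\<^sup>2 / 2 * (norm (?\<sigma> i))\<^sup>2" for i
      using power2_norm_add_le_young[of 1 "?\<Delta> i" "(p / 2) *\<^sub>R ?\<sigma> i"]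
      by (simp add: a_def power_mult_distrib power_divide)
    then have "(\<Sum>i\<in>{1..n}. (norm (a i))\<^sup>2)
        \<le> 2 * (\<Sum>i\<in>{1..n}. (norm (?\<Delta> i))\<^sup>2) + p\<^sup>2 / 2 * (\<Sum>i\<in>{1..n}. (norm (?\<sigma> i))\<^sup>2)"
      unfolding sum_distrib_left sum.distrib[symmetric] by (intro sum_mono)
    then have "(\<Sum>i\<in>{1..n}. (norm (a i))\<^sup>2) / real n
        \<le> (2 * (\<Sum>i\<in>{1..n}. (norm (?\<Delta> i))\<^sup>2) + p\<^sup>2 / 2 * (\<Sum>i\<in>{1..n}. (norm (?\<sigma> i))\<^sup>2)) / real n"
      by (intro divide_right_mono) auto
    also have "\<dots> = 2 * ((\<Sum>i\<in>{1..n}. (norm (?\<Delta> i))\<^sup>2) / real n) + p\<^sup>2 / 2 * staleness k S"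
      by (simp add: staleness_def add_divide_distrib)
    finally show ?thesis
      using mean_sq_gradient_change[OF S k] by linarith
  qed
  have "measure_pmf.expectation Q (\<lambda>B. (norm (err (Suc k) (S[k := B])))\<^sup>2)
      = measure_pmf.expectation Q
          (\<lambda>B. (norm ((1 - p / 2) *\<^sub>R err k S + (1 / real b) *\<^sub>R (\<Sum>i\<leftarrow>B. a i - m)))\<^sup>2)"
    by (intro expectation_cong_pmf) (simp only: err)
  also have "\<dots> \<le> (norm ((1 - p / 2) *\<^sub>R err k S))\<^sup>2 + (\<Sum>i\<in>{1..n}. (norm (a i))\<^sup>2) / real n / real b"
    unfolding m_def by (rule expectation_batch_mean_error[OF n_pos b(1)])
  also have "\<dots> \<le> (1 - 3 * p / 4) * (norm (err k S))\<^sup>2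
      + (2 * (mean_sq_L * D\<^sup>2 * (\<eta> k)\<^sup>2) + p\<^sup>2 / 2 * staleness k S) / real b"
  proof (rule add_mono)
    have "p * p \<le> p"
      using p_bounds by (simp add: mult_left_le)
    then have "(1 - p / 2)\<^sup>2 \<le> 1 - 3 * p / 4"
      by (simp add: power2_eq_square algebra_simps)
    then show "(norm ((1 - p / 2) *\<^sub>R err k S))\<^sup>2 \<le> (1 - 3 * p / 4) * (norm (err k S))\<^sup>2"
      by (simp add: power_mult_distrib mult_right_mono)
  qed (use mean_a b in \<open>intro divide_right_mono, auto\<close>)
  also have "\<dots> = (1 - 3 * p / 4) * (norm (err k S))\<^sup>2
      + 2 / real b * (mean_sq_L * D\<^sup>2 * (\<eta> k)\<^sup>2) + p\<^sup>2 / (2 * real b) * staleness k S"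
    using b by (simp add: field_simps)
  finally show ?thesis .
qed

text \<open>
  A stored gradient survives a step with probability \<open>(1 - 1 / n) ^ b \<le> 1 / (1 + p)\<close>.  The weight
  \<open>p / 4\<close> in Young's inequality keeps a contraction by \<open>1 - 3 p / 8\<close>.
\<close>
lemma staleness_step:
  assumes S: "S \<in> set_pmf P" and k: "k < K"
  shows "measure_pmf.expectation Q (\<lambda>B. staleness (Suc k) (S[k := B]))
    \<le> (1 - 3 * p / 8) * staleness k S + 5 / p * (mean_sq_L * D\<^sup>2 * (\<eta> k)\<^sup>2)"
proof -
  let ?q = "(1 - 1 / real n) ^ b"
  let ?\<Delta> = "\<lambda>i. G i (x (Suc k) S) - G i (x k S)"
  let ?\<sigma> = "\<lambda>i. G i (x k S) - y k S i"
  let ?w = "\<lambda>i. (norm (G i (x (Suc k) S) - y k S i))\<^sup>2"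
  have q: "0 \<le> ?q" "?q \<le> 1 / (1 + p)"
    using n_pos one_minus_inverse_power_le[OF n_pos, of b] by (auto simp: p_def)
  have st: "staleness (Suc k) (S[k := B]) = (\<Sum>i\<in>{1..n}. if i \<in> set B then 0 else ?w i) / real n"
    if B: "B \<in> set_pmf Q" for B
    unfolding staleness_def
    using step(4)[OF resample_in_P[OF S B, of k] k] resample[OF S B k]
    by (intro arg_cong[where f = "\<lambda>t. t / real n"] sum.cong) auto
  have "measure_pmf.expectation Q (\<lambda>B. staleness (Suc k) (S[k := B]))
      = measure_pmf.expectation Q (\<lambda>B. (\<Sum>i\<in>{1..n}. if i \<in> set B then 0 else ?w i) / real n)"
    by (intro expectation_cong_pmf) (simp only: st)
  also have "\<dots> = (\<Sum>i\<in>{1..n}. measure_pmf.expectation Q (\<lambda>B. if i \<in> set B then 0 else ?w i)) / real n"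
    using finite_Q by (simp add: integrable_measure_pmf_finite Bochner_Integration.integral_sum)
  also have "\<dots> = ?q * ((\<Sum>i\<in>{1..n}. ?w i) / real n)"
    using expectation_batch_not_drawn[of _ n b] by (simp add: sum_distrib_left)
  also have "\<dots> \<le> 1 / (1 + p) * ((1 + p / 4) * staleness k S + (1 + 4 / p) * (mean_sq_L * D\<^sup>2 * (\<eta> k)\<^sup>2))"
  proof (intro mult_mono q)
    have "?w i \<le> (1 + p / 4) * (norm (?\<sigma> i))\<^sup>2 + (1 + 4 / p) * (norm (?\<Delta> i))\<^sup>2" for i
      using power2_norm_add_le_young[of "p / 4" "?\<sigma> i" "?\<Delta> i"] p_bounds by simp
    then have "(\<Sum>i\<in>{1..n}. ?w i)
        \<le> (1 + p / 4) * (\<Sum>i\<in>{1..n}. (norm (?\<sigma> i))\<^sup>2) + (1 + 4 / p) * (\<Sum>i\<in>{1..n}. (norm (?\<Delta> i))\<^sup>2)"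
      unfolding sum_distrib_left sum.distrib[symmetric] by (intro sum_mono)
    then have "(\<Sum>i\<in>{1..n}. ?w i) / real n
        \<le> ((1 + p / 4) * (\<Sum>i\<in>{1..n}. (norm (?\<sigma> i))\<^sup>2)
          + (1 + 4 / p) * (\<Sum>i\<in>{1..n}. (norm (?\<Delta> i))\<^sup>2)) / real n"
      by (intro divide_right_mono) auto
    also have "\<dots> = (1 + p / 4) * staleness k S
        + (1 + 4 / p) * ((\<Sum>i\<in>{1..n}. (norm (?\<Delta> i))\<^sup>2) / real n)"
      by (simp add: staleness_def add_divide_distrib)
    also have "\<dots> \<le> (1 + p / 4) * staleness k S + (1 + 4 / p) * (mean_sq_L * D\<^sup>2 * (\<eta> k)\<^sup>2)"
      using p_bounds mean_sq_gradient_change[OF S k] by (intro add_left_mono mult_left_mono) auto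
    finally show "(\<Sum>i\<in>{1..n}. ?w i) / real n
        \<le> (1 + p / 4) * staleness k S + (1 + 4 / p) * (mean_sq_L * D\<^sup>2 * (\<eta> k)\<^sup>2)" .
  qed (use p_bounds in \<open>auto intro!: divide_nonneg_nonneg sum_nonneg\<close>)
  also have "\<dots> = (1 + p / 4) / (1 + p) * staleness k S
      + (1 + 4 / p) / (1 + p) * (mean_sq_L * D\<^sup>2 * (\<eta> k)\<^sup>2)"
    by (simp add: distrib_left)
  also have "\<dots> \<le> (1 - 3 * p / 8) * staleness k S + 5 / p * (mean_sq_L * D\<^sup>2 * (\<eta> k)\<^sup>2)"
  proof (intro add_mono mult_right_mono)
    have "p * p \<le> p"
      using p_bounds by (simp add: mult_left_le)
    moreover have "(1 - 3 * p / 8) * (1 + p) = 1 + 5 * p / 8 - 3 / 8 * (p * p)"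
      by (simp add: field_simps)
    ultimately have "1 + p / 4 \<le> (1 - 3 * p / 8) * (1 + p)"
      by linarith
    then show "(1 + p / 4) / (1 + p) \<le> 1 - 3 * p / 8"
      using p_bounds by (simp add: pos_divide_le_eq)
    have "(1 + 4 / p) / (1 + p) \<le> 1 + 4 / p"
      using p_bounds divide_left_mono[of 1 "1 + p" "1 + 4 / p"] by simp
    also have "\<dots> \<le> 5 / p"
      using p_bounds by (simp add: field_simps)
    finally show "(1 + 4 / p) / (1 + p) \<le> 5 / p" .
  qed (use mean_sq_L_nonneg in \<open>auto simp: staleness_def intro!: divide_nonneg_nonneg sum_nonneg\<close>)
  finally show ?thesis .
qed

text \<open>
  The Lyapunov function adds to the second moment of the error the expected staleness with weight
  \<open>8 p / b\<close>.  With this weight, the staleness fed into the error costs only \<open>p / 16\<close> of the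
  contraction \<open>3 p / 8\<close>, so that \<open>5 p / 16\<close> is left; this exceeds the rate \<open>p / 4\<close> at which the
  squared step sizes may shrink.
\<close>
lemma second_moment_err:
  assumes "k \<le> K"
  shows "measure_pmf.expectation P (\<lambda>S. (norm (err k S))\<^sup>2)
    \<le> 672 * mean_sq_L * D\<^sup>2 * real n / (real b)\<^sup>2 * (\<eta> k)\<^sup>2"
proof -
  define V where "V k = measure_pmf.expectation P (\<lambda>S. (norm (err k S))\<^sup>2)" for k
  define T where "T k = measure_pmf.expectation P (\<lambda>S. staleness k S)" for k
  define \<Phi> where "\<Phi> k = V k + 8 * p / real b * T k" for k
  define W where "W = 42 / real b * mean_sq_L * D\<^sup>2"
  note int = integrable_measure_pmf_finite[OF finite_P]
  have T_nonneg: "0 \<le> T k" for k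
    unfolding T_def staleness_def by (intro integral_nonneg_AE) (auto intro!: sum_nonneg divide_nonneg_nonneg)
  have "\<Phi> k \<le> 16 * W / p * (\<eta> k)\<^sup>2"
  proof (rule lyapunov_tracks_step_size[where N = K])
    have "err 0 S = 0" "staleness 0 S = 0" if "S \<in> set_pmf P" for S
      using init[OF that] by (auto simp: err_def staleness_def)
    then have "V 0 = measure_pmf.expectation P (\<lambda>S. 0)" "T 0 = measure_pmf.expectation P (\<lambda>S. 0)"
      unfolding V_def T_def by (intro expectation_cong_pmf; simp)+
    then show "\<Phi> 0 \<le> 0"
      by (simp add: \<Phi>_def)
  next
    fix k assume k: "k < K"
    let ?N = "mean_sq_L * D\<^sup>2 * (\<eta> k)\<^sup>2"
    have "V (Suc k) \<le> measure_pmf.expectation P (\<lambda>S. (1 - 3 * p / 4) * (norm (err k S))\<^sup>2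
        + 2 / real b * ?N + p\<^sup>2 / (2 * real b) * staleness k S)"
      unfolding V_def expectation_resample[OF k, of "\<lambda>S. (norm (err (Suc k) S))\<^sup>2"]
      using finite_P err_step k by (intro expectation_mono_finite) auto
    also have "\<dots> = (1 - 3 * p / 4) * V k + 2 / real b * ?N + p\<^sup>2 / (2 * real b) * T k"
      by (simp add: V_def T_def int)
    finally have V: "V (Suc k) \<le> (1 - 3 * p / 4) * V k + 2 / real b * ?N + p\<^sup>2 / (2 * real b) * T k" .
    have "T (Suc k) \<le> measure_pmf.expectation P (\<lambda>S. (1 - 3 * p / 8) * staleness k S + 5 / p * ?N)"
      unfolding T_def expectation_resample[OF k, of "\<lambda>S. staleness (Suc k) S"]
      using finite_P staleness_step k by (intro expectation_mono_finite) auto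
    also have "\<dots> = (1 - 3 * p / 8) * T k + 5 / p * ?N"
      by (simp add: T_def int)
    finally have "8 * p / real b * T (Suc k) \<le> 8 * p / real b * ((1 - 3 * p / 8) * T k + 5 / p * ?N)"
      using p_bounds by (intro mult_left_mono) auto
    then have "\<Phi> (Suc k) \<le> (1 - 3 * p / 4) * V k + 2 / real b * ?N + p\<^sup>2 / (2 * real b) * T k
        + 8 * p / real b * ((1 - 3 * p / 8) * T k + 5 / p * ?N)"
      using V by (simp add: \<Phi>_def)
    also have "\<dots> = (1 - 3 * p / 4) * V k + (1 - 5 * p / 16) * (8 * p / real b * T k) + W * (\<eta> k)\<^sup>2"
      using p_bounds b by (simp add: W_def field_simps power2_eq_square)
    also have "\<dots> \<le> (1 - 5 * p / 16) * V k + (1 - 5 * p / 16) * (8 * p / real b * T k) + W * (\<eta> k)\<^sup>2"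
      using p_bounds by (intro add_right_mono mult_right_mono) (auto simp: V_def)
    also have "\<dots> = (1 - 5 * p / 16) * \<Phi> k + W * (\<eta> k)\<^sup>2"
      by (simp add: \<Phi>_def algebra_simps)
    finally show "\<Phi> (Suc k) \<le> (1 - 5 * p / 16) * \<Phi> k + W * (\<eta> k)\<^sup>2" .
  qed (use p_bounds \<eta>_pos \<eta>_decay assms mean_sq_L_nonneg in \<open>auto simp: W_def p_def less_imp_le\<close>)
  moreover have "V k \<le> \<Phi> k"
    using T_nonneg p_bounds by (simp add: \<Phi>_def)
  moreover have "16 * W / p = 672 * mean_sq_L * D\<^sup>2 * real n / (real b)\<^sup>2"
    by (simp add: W_def p_def power2_eq_square)
  ultimately show ?thesis
    by (simp add: V_def)
qed

text \<open>
  The Frank-Wolfe step with an inexact gradient: optimality of the linear minimizer is compared with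
  the direction towards \<open>xstar\<close>, where convexity supplies the decrease, and the error of the gradient
  costs at most \<open>D\<close> times its norm.
\<close>
lemma suboptimality_step:
  assumes S: "S \<in> set_pmf P" and k: "k < K"
  shows "avg n f (x (Suc k) S) - avg n f xstar
    \<le> (1 - \<eta> k) * (avg n f (x k S) - avg n f xstar) + \<eta> k * D * norm (err k S)
      + L * D\<^sup>2 / 2 * (\<eta> k)\<^sup>2"
proof -
  let ?F = "avg n f" and ?x = "x k S" and ?s = "s (take k S)"
  have X: "?x \<in> X" "x (Suc k) S \<in> X" "?s \<in> X" "xstar \<in> X"
    using x_in_X[OF S] s_in_X[OF S] k xstar by (auto simp: is_arg_min_def)
  have "g k S \<bullet> ?s \<le> g k S \<bullet> xstar"
    using step(1)[OF S k] X(4) by (simp add: is_arg_min_def not_less)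
  moreover have "?F xstar \<ge> ?F ?x + Gavg ?x \<bullet> (xstar - ?x)"
    using grad_convex X by (simp add: grad_convex_on_def)
  moreover have "err k S \<bullet> (xstar - ?s) \<le> norm (err k S) * D"
  proof -
    have "err k S \<bullet> (xstar - ?s) \<le> norm (err k S) * norm (xstar - ?s)"
      by (rule norm_cauchy_schwarz)
    also have "\<dots> \<le> norm (err k S) * D"
      using X by (intro mult_left_mono diameter) auto
    finally show ?thesis .
  qed
  ultimately have dir: "Gavg ?x \<bullet> (?s - ?x) \<le> norm (err k S) * D - (?F ?x - ?F xstar)"
    by (simp add: err_def inner_diff_left inner_diff_right)
  have "?F (x (Suc k) S) \<le> ?F ?x + Gavg ?x \<bullet> (x (Suc k) S - ?x) + L / 2 * (norm (x (Suc k) S - ?x))\<^sup>2"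
    using X avg_differentiable_in_X by (intro smooth_on_upper_bound[OF X_convex X_subset _ _ L_smooth])
  also have "\<dots> = ?F ?x + \<eta> k * (Gavg ?x \<bullet> (?s - ?x)) + L / 2 * (norm (x (Suc k) S - ?x))\<^sup>2"
    using step(2)[OF S k] by simp
  also have "\<dots> \<le> ?F ?x + \<eta> k * (norm (err k S) * D - (?F ?x - ?F xstar)) + L / 2 * (\<eta> k * D)\<^sup>2"
    using dir \<eta>_pos[of k] norm_step_le[OF S k] L_pos
    by (intro add_mono mult_left_mono power_mono order_refl) auto
  finally show ?thesis
    by (simp add: algebra_simps power_mult_distrib)
qed

lemma expected_suboptimality_step:
  assumes "k < K"
  shows "measure_pmf.expectation P (\<lambda>S. avg n f (x (Suc k) S) - avg n f xstar)
    \<le> (1 - \<eta> k) * measure_pmf.expectation P (\<lambda>S. avg n f (x k S) - avg n f xstar)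
      + (26 * (sqrt mean_sq_L * sqrt (real n) / real b) + L / 2) * D\<^sup>2 * (\<eta> k)\<^sup>2"
proof -
  let ?gap = "\<lambda>k S. avg n f (x k S) - avg n f xstar"
  let ?R = "26 * (sqrt mean_sq_L * sqrt (real n) / real b)"
  note int = integrable_measure_pmf_finite[OF finite_P]
  have "measure_pmf.expectation P (\<lambda>S. norm (err k S))
      \<le> sqrt (measure_pmf.expectation P (\<lambda>S. (norm (err k S))\<^sup>2))"
    by (rule expectation_le_sqrt_second_moment[OF finite_P])
  also have "\<dots> \<le> sqrt (672 * mean_sq_L * D\<^sup>2 * real n / (real b)\<^sup>2 * (\<eta> k)\<^sup>2)"
    using second_moment_err[of k] assms by simp
  also have "\<dots> \<le> sqrt ((?R * D * \<eta> k)\<^sup>2)"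
  proof (rule real_sqrt_le_mono)
    define Z where "Z = mean_sq_L * D\<^sup>2 * real n / (real b)\<^sup>2 * (\<eta> k)\<^sup>2"
    have "672 * mean_sq_L * D\<^sup>2 * real n / (real b)\<^sup>2 * (\<eta> k)\<^sup>2 = 672 * Z"
      by (simp add: Z_def)
    also have "\<dots> \<le> 676 * Z"
    proof -
      have "0 \<le> Z"
        unfolding Z_def using mean_sq_L_nonneg by simp
      then show ?thesis
        by simp
    qed
    also have "\<dots> = (?R * D * \<eta> k)\<^sup>2"
      using mean_sq_L_nonneg by (simp add: Z_def power_mult_distrib power_divide)
    finally show "672 * mean_sq_L * D\<^sup>2 * real n / (real b)\<^sup>2 * (\<eta> k)\<^sup>2 \<le> (?R * D * \<eta> k)\<^sup>2" .
  qed
  also have "\<dots> = ?R * D * \<eta> k"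
    using mean_sq_L_nonneg D_pos \<eta>_pos[of k] by simp
  finally have err: "measure_pmf.expectation P (\<lambda>S. norm (err k S)) \<le> ?R * D * \<eta> k" .
  have "measure_pmf.expectation P (?gap (Suc k)) \<le> measure_pmf.expectation P
      (\<lambda>S. (1 - \<eta> k) * ?gap k S + \<eta> k * D * norm (err k S) + L * D\<^sup>2 / 2 * (\<eta> k)\<^sup>2)"
    using finite_P suboptimality_step assms by (intro expectation_mono_finite) auto
  also have "\<dots> = (1 - \<eta> k) * measure_pmf.expectation P (?gap k)
      + \<eta> k * D * measure_pmf.expectation P (\<lambda>S. norm (err k S)) + L * D\<^sup>2 / 2 * (\<eta> k)\<^sup>2"
    by (simp add: int)
  also have "\<dots> \<le> (1 - \<eta> k) * measure_pmf.expectation P (?gap k)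
      + \<eta> k * D * (?R * D * \<eta> k) + L * D\<^sup>2 / 2 * (\<eta> k)\<^sup>2"
    using err D_pos \<eta>_pos[of k] by (intro add_mono mult_left_mono order_refl) auto
  also have "\<dots> = (1 - \<eta> k) * measure_pmf.expectation P (?gap k) + (?R + L / 2) * D\<^sup>2 * (\<eta> k)\<^sup>2"
    by (simp add: algebra_simps power2_eq_square)
  finally show ?thesis .
qed

lemma expected_suboptimality_0:
  "measure_pmf.expectation P (\<lambda>S. avg n f (x 0 S) - avg n f xstar) = avg n f x0 - avg n f xstar"
proof -
  have "measure_pmf.expectation P (\<lambda>S. avg n f (x 0 S) - avg n f xstar)
      = measure_pmf.expectation P (\<lambda>S. avg n f x0 - avg n f xstar)"
    using init(1) by (intro expectation_cong_pmf) simp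
  then show ?thesis by simp
qed

end

theorem theorem4p5:
  shows "\<exists>C>0. \<forall>(d::nat) (n::nat) (b::nat) (K::nat) (X::vec set) (f::nat \<Rightarrow> vec \<Rightarrow> real)
      (L::real) (Li::nat \<Rightarrow> real) (D::real) (x0::vec) (xstar::vec)
      (s::nat list list \<Rightarrow> vec) (x::nat \<Rightarrow> nat list list \<Rightarrow> vec)
      (g::nat \<Rightarrow> nat list list \<Rightarrow> vec) (y::nat \<Rightarrow> nat list list \<Rightarrow> nat \<Rightarrow> vec).
    1 \<le> b \<and> b \<le> n \<and> 1 \<le> K \<and>
    X \<subseteq> Rd d \<and> X \<noteq> {} \<and> convex X \<and> compact X \<and>
    0 < D \<and> (\<forall>u\<in>X. \<forall>v\<in>X. norm (u - v) \<le> D) \<and>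
    (\<forall>i\<in>{1..n}. differentiable_near d X (f i)) \<and>
    0 < L \<and> smooth_on d X L (avg n f) \<and>
    (\<forall>i\<in>{1..n}. 0 < Li i \<and> smooth_on d X (Li i) (f i)) \<and>
    grad_convex_on d X (avg n f) \<and>
    is_arg_min (avg n f) (\<lambda>u. u \<in> X) xstar \<and>
    x0 \<in> X \<and>
    saga_sarah_fw d X n f b (real b / (2 * real n)) (step_size n b K) K x0 s x g y
    \<longrightarrow>
    measure_pmf.expectation (batches_pmf n b K) (\<lambda>S. avg n f (x K S) - avg n f xstar)
      \<le> C * (real n * (avg n f x0 - avg n f xstar) / real b * exp (- (real b * real K / (8 * real n)))
             + (1 + sqrt ((\<Sum>i\<in>{1..n}. (Li i)\<^sup>2) / real n) * sqrt (real n) / (L * real b))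
               * (L * D\<^sup>2 / real K))"
  \<comment> \<open>The factor 22 comes from the rate of the scalar recursion, and 26 bounds \<open>sqrt 672\<close> in the
    estimate of the gradient error; their product is 572.\<close>
proof (intro exI[of _ 572] conjI allI impI)
  fix d n b K :: nat and X :: "vec set" and f :: "nat \<Rightarrow> vec \<Rightarrow> real"
    and L :: real and Li :: "nat \<Rightarrow> real" and D :: real and x0 xstar :: vec
    and s :: "nat list list \<Rightarrow> vec" and x g :: "nat \<Rightarrow> nat list list \<Rightarrow> vec"
    and y :: "nat \<Rightarrow> nat list list \<Rightarrow> nat \<Rightarrow> vec"
  assume *: "1 \<le> b \<and> b \<le> n \<and> 1 \<le> K \<and>
    X \<subseteq> Rd d \<and> X \<noteq> {} \<and> convex X \<and> compact X \<and>
    0 < D \<and> (\<forall>u\<in>X. \<forall>v\<in>X. norm (u - v) \<le> D) \<and>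
    (\<forall>i\<in>{1..n}. differentiable_near d X (f i)) \<and>
    0 < L \<and> smooth_on d X L (avg n f) \<and>
    (\<forall>i\<in>{1..n}. 0 < Li i \<and> smooth_on d X (Li i) (f i)) \<and>
    grad_convex_on d X (avg n f) \<and>
    is_arg_min (avg n f) (\<lambda>u. u \<in> X) xstar \<and>
    x0 \<in> X \<and>
    saga_sarah_fw d X n f b (real b / (2 * real n)) (step_size n b K) K x0 s x g y"
  then have b: "1 \<le> b" "b \<le> n" and K: "1 \<le> K" and L: "0 < L"
    by blast+
  interpret saga_sarah_run d n b K X f L Li D x0 xstar "step_size n b K" s x g y
    using * step_size_bounds[OF b] by unfold_locales blast+
  let ?gap = "\<lambda>k. measure_pmf.expectation (batches_pmf n b K) (\<lambda>S. avg n f (x k S) - avg n f xstar)"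
  define E where "E = exp (- (real b * real K / (8 * real n)))"
  define A where "A = avg n f x0 - avg n f xstar"
  define T where "T = sqrt mean_sq_L * sqrt (real n) / real b"
  define M where "M = (26 * T + L / 2) * D\<^sup>2"
  have A: "0 \<le> A"
    using x0 xstar by (auto simp: A_def is_arg_min_def not_less)
  have T: "0 \<le> T"
    using mean_sq_L_nonneg by (simp add: T_def)
  have "?gap K \<le> 2 * (?gap 0 * exp (- (real b * real K / (8 * real n)))) + 22 * M / real K"
  proof (rule step_size_rate[OF b K])
    show "0 \<le> ?gap 0"
      using A by (simp add: expected_suboptimality_0 A_def)
    show "0 \<le> M"
      using T L by (simp add: M_def)
    show "?gap (Suc k) \<le> (1 - step_size n b K k) * ?gap k + M * (step_size n b K k)\<^sup>2" if "k < K" for k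
      using expected_suboptimality_step[OF that] by (simp only: M_def T_def)
  qed
  also have "\<dots> = 2 * (A * E) + 22 * M / real K"
    by (simp add: expected_suboptimality_0 A_def E_def)
  also have "\<dots> \<le> 572 * (real n * A / real b * E) + 572 * ((L + T) * (D\<^sup>2 / real K))"
  proof (rule add_mono)
    have "A * 1 \<le> A * (real n / real b)"
      using b A by (intro mult_left_mono) auto
    then have "A * E \<le> real n * A / real b * E"
      by (intro mult_right_mono) (auto simp: E_def mult.commute)
    moreover have "0 \<le> A * E"
      using A by (simp add: E_def)
    ultimately show "2 * (A * E) \<le> 572 * (real n * A / real b * E)"
      by linarith
    have "22 * M / real K = 22 * (26 * T + L / 2) * (D\<^sup>2 / real K)"
      by (simp add: M_def)
    also have "\<dots> \<le> 572 * (L + T) * (D\<^sup>2 / real K)"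
      using L by (intro mult_right_mono) auto
    finally show "22 * M / real K \<le> 572 * ((L + T) * (D\<^sup>2 / real K))"
      by (simp only: mult.assoc)
  qed
  also have "(L + T) * (D\<^sup>2 / real K)
      = (1 + sqrt mean_sq_L * sqrt (real n) / (L * real b)) * (L * D\<^sup>2 / real K)"
    using L b K by (simp add: T_def field_simps)
  finally show "?gap K \<le> 572 * (real n * (avg n f x0 - avg n f xstar) / real b
        * exp (- (real b * real K / (8 * real n)))
      + (1 + sqrt ((\<Sum>i\<in>{1..n}. (Li i)\<^sup>2) / real n) * sqrt (real n) / (L * real b))
        * (L * D\<^sup>2 / real K))"
    by (simp only: A_def E_def mean_sq_L_def distrib_left)
qed simp

end
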